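(* Let $1<p<\infty$, let $\Omega\subset\mathbb{R}^N$ be an open bounded set, and let $c\in L^\infty(\Omega)$ satisfy $$c(x)\le\rho_N(p)+h_\Omega(x)\quad\text{for a.e. }x\in\Omega.$$ Suppose $u,v\in X^p_0(\Omega)$ are such that either $u\in L^\infty(\Omega)$ or $v\in L^\infty(\Omega)$, and that weakly $$L_{\Delta_p}u-c(x)|u|^{p-2}u\ge L_{\Delta_p}v-c(x)|v|^{p-2}v\quad\text{in }\Omega,\qquad u=0=v\quad\text{in }\mathbb{R}^N\setminus\Omega.$$ Then either $u\equiv v$ in $\mathbb{R}^N$ or $u>v$ in $\Omega$ in the sense that $$\operatorname*{ess\,inf}_K(u-v)>0\quad\text{for all compact sets }K\subset\Omega.$$
   Context: $g(a)=|a|^{p-2}a$ (with $g(0)=0$), $\Gamma$ is the Gamma function, $\psi=\Gamma'/\Gamma$, $\gamma=-\Gamma'(1)$, $C_{N,p}=\frac{p\,\Gamma(N/2)}{2\pi^{N/2}}$, $\rho_N(p)=2\ln2-\gamma+\frac p2\psi(\frac N2)$, and for $x\in\Omega$ $$h_\Omega(x)=C_{N,p}\int_{B_1(x)\setminus\Omega}|x-y|^{-N}\,dy-C_{N,p}\int_{\Omega\setminus B_1(x)}|x-y|^{-N}\,dy.$$ $$X^p_0(\Omega)=\Big\{u\in L^p(\mathbb{R}^N): u=0\text{ a.e. on }\mathbb{R}^N\setminus\Omega,\ \int_{\mathbb{R}^N}\int_{B_1(x)}\frac{|u(x)-u(y)|^p}{|x-y|^N}\,dy\,dx<\infty\Big\}.$$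 For $u,v\in X^p_0(\Omega)$, $$\begin{aligned}\mathcal{E}_{L,p}(u,v)&=\frac{C_{N,p}}{2}\iint_{|x-y|<1}\frac{g(u(x)-u(y))(v(x)-v(y))}{|x-y|^N}\,dx\,dy+\rho_N(p)\int_{\mathbb{R}^N}g(u(x))v(x)\,dx\\&\quad+\frac{C_{N,p}}{2}\iint_{|x-y|\ge1}\frac{g(u(x)-u(y))(v(x)-v(y))-g(u(x))v(x)-g(u(y))v(y)}{|x-y|^N}\,dx\,dy.\end{aligned}$$ The weak inequality $L_{\Delta_p}u-c\,g(u)\ge L_{\Delta_p}v-c\,g(v)$ in $\Omega$ means $$\mathcal{E}_{L,p}(u,\varphi)-\int_\Omega c\,g(u)\varphi\,dx\ \ge\ \mathcal{E}_{L,p}(v,\varphi)-\int_\Omega c\,g(v)\varphi\,dx\quad\text{for all nonnegative }\varphi\in X^p_0(\Omega).$$ *)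

theory Defs
  imports "HOL-Analysis.Analysis" "HOL-Probability.Essential_Supremum"
begin

text \<open>
  The space $\mathbb{R}^N$ is an arbitrary type of class \<^class>\<open>euclidean_space\<close>, with
  $N$ its dimension. Functions are total, and equality of elements of $L^p$ is equality almost
  everywhere. The functions $\psi = \Gamma'/\Gamma$ and $\gamma = -\Gamma'(1)$ are the library's
  \<^const>\<open>Digamma\<close> and \<^const>\<open>euler_mascheroni\<close>.
\<close>

lemma Digamma_eq_deriv_Gamma:
  fixes x :: real
  assumes "x > 0"
  shows "Digamma x = deriv Gamma x / Gamma x"
proof -
  have x: "x \<notin> \<int>\<^sub>\<le>\<^sub>0"
    using assms by (auto elim!: nonpos_Ints_cases)
  have "(Gamma has_field_derivative Gamma x * Digamma x) (at x)"
    using x by (rule has_field_derivative_Gamma)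
  then have "deriv Gamma x = Gamma x * Digamma x"
    by (rule DERIV_imp_deriv)
  moreover have "Gamma x \<noteq> 0"
    using x by (simp add: Gamma_eq_zero_iff)
  ultimately show ?thesis
    by simp
qed

lemma euler_mascheroni_eq_deriv_Gamma: "(euler_mascheroni :: real) = - deriv Gamma (1 :: real)"
  using Digamma_eq_deriv_Gamma[of 1] by simp

definition gpow :: "real \<Rightarrow> real \<Rightarrow> real" where
  "gpow p a = \<bar>a\<bar> powr (p - 2) * a"

definition C_const :: "nat \<Rightarrow> real \<Rightarrow> real" where
  "C_const N p = p * Gamma (real N / 2) / (2 * pi powr (real N / 2))"

definition rho :: "nat \<Rightarrow> real \<Rightarrow> real" where
  "rho N p = 2 * ln 2 - euler_mascheroni + p / 2 * Digamma (real N / 2)"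

definition h_fun :: "real \<Rightarrow> 'a::euclidean_space set \<Rightarrow> 'a \<Rightarrow> real" where
  "h_fun p \<Omega> x =
     C_const DIM('a) p * (LINT y:ball x 1 - \<Omega>|lebesgue. 1 / norm (x - y) ^ DIM('a))
   - C_const DIM('a) p * (LINT y:\<Omega> - ball x 1|lebesgue. 1 / norm (x - y) ^ DIM('a))"

definition X0 :: "real \<Rightarrow> 'a::euclidean_space set \<Rightarrow> ('a \<Rightarrow> real) set" where
  "X0 p \<Omega> = {u. u \<in> borel_measurable lebesgue
      \<and> integrable lebesgue (\<lambda>x. \<bar>u x\<bar> powr p)
      \<and> (AE x in lebesgue. x \<notin> \<Omega> \<longrightarrow> u x = 0)
      \<and> (\<integral>\<^sup>+ x. (\<integral>\<^sup>+ y\<in>ball x 1. ennreal (\<bar>u x - u y\<bar> powr p / norm (x - y) ^ DIM('a)) \<partial>lebesgue) \<partial>lebesgue) < \<infinity>}"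

definition E_form :: "real \<Rightarrow> ('a::euclidean_space \<Rightarrow> real) \<Rightarrow> ('a \<Rightarrow> real) \<Rightarrow> real" where
  "E_form p u v =
     C_const DIM('a) p / 2 *
       (LINT (x, y):{(x, y). norm (x - y) < 1}|(lebesgue \<Otimes>\<^sub>M lebesgue).
          gpow p (u x - u y) * (v x - v y) / norm (x - y) ^ DIM('a))
   + rho DIM('a) p * (LINT x|lebesgue. gpow p (u x) * v x)
   + C_const DIM('a) p / 2 *
       (LINT (x, y):{(x, y). norm (x - y) \<ge> 1}|(lebesgue \<Otimes>\<^sub>M lebesgue).
          (gpow p (u x - u y) * (v x - v y) - gpow p (u x) * v x - gpow p (u y) * v y)
            / norm (x - y) ^ DIM('a))"

text \<open>The weak inequality $L_{\Delta_p} u - c\,g(u) \ge L_{\Delta_p} v - c\,g(v)$ in $\Omega$.\<close>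

definition weak_ge ::
  "real \<Rightarrow> 'a::euclidean_space set \<Rightarrow> ('a \<Rightarrow> real) \<Rightarrow> ('a \<Rightarrow> real) \<Rightarrow> ('a \<Rightarrow> real) \<Rightarrow> bool" where
  "weak_ge p \<Omega> c u v \<longleftrightarrow>
     (\<forall>\<phi> \<in> X0 p \<Omega>. (AE x in lebesgue. 0 \<le> \<phi> x) \<longrightarrow>
        E_form p u \<phi> - (LINT x:\<Omega>|lebesgue. c x * gpow p (u x) * \<phi> x)
      \<ge> E_form p v \<phi> - (LINT x:\<Omega>|lebesgue. c x * gpow p (v x) * \<phi> x))"

definition L_inf :: "'a::euclidean_space set \<Rightarrow> ('a \<Rightarrow> real) set" where
  "L_inf \<Omega> = {f. f \<in> borel_measurable (lebesgue_on \<Omega>)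
      \<and> esssup (lebesgue_on \<Omega>) (\<lambda>x. ereal \<bar>f x\<bar>) < \<infinity>}"

text \<open>Extended-real valued, so that it is $\infty$ when the set is Lebesgue-null.\<close>

definition ess_inf_on :: "'a::euclidean_space set \<Rightarrow> ('a \<Rightarrow> real) \<Rightarrow> ereal" where
  "ess_inf_on K f = - esssup (lebesgue_on K) (\<lambda>x. - ereal (f x))"

end

theory Submission
  imports Defs
begin

text \<open>
  \<^bold>\<open>Regional form.\<close> The kernel of the logarithmic $p$-Laplacian is $|x-y|^{-N}$, and for functions that vanish
  outside $\Omega$ the form $\mathcal{E}_{L,p}(u,\varphi)$ equals
  $\frac{C_{N,p}}{2}\iint_{\Omega\times\Omega} g(u(x)-u(y))(\varphi(x)-\varphi(y))|x-y|^{-N}\,dx\,dy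
    + \int_\Omega (\rho_N(p) + h_\Omega)\,g(u)\,\varphi\,dx$ (lemma \<open>E_form_regional\<close>). The hypothesis on $c$ says
  that the potential $\rho_N(p) + h_\Omega - c$ of the resulting inequality is nonnegative.

  \<^bold>\<open>Weak comparison.\<close> With the test function $(v-u)^+$ all terms have a sign, so they vanish, and
  $(v-u)^+$ is constant on $\Omega$. Since the kernel is of logarithmic order, the constant is not excluded by
  the energy space, which can contain multiples of the indicator of $\Omega$. It is excluded by the potential:
  the constant can be positive only if $c = \rho_N(p) + h_\Omega$, but $h_\Omega$ is unbounded on every bounded
  nonempty open set (lemma \<open>h_fun_unbounded\<close>). Hence $u \ge v$ (lemma \<open>weak_comparison\<close>).

  \<^bold>\<open>Strong comparison.\<close> If $u$ and $v$ differ, then $u - v \ge \delta > 0$ on a set $A \subseteq \Omega$ of positive measure.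
  Raise $v$ to $v + \varepsilon f$ with a Lipschitz cutoff $f$ that is $1$ on $K$, and test with the part
  of $v + \varepsilon f$ above $u$. The set $A$ acts nonlocally on the support of $f$ with a strength that does not
  depend on $\varepsilon$. The cost of raising $v$ is $O(\varepsilon^q)$ with $q = \min(1,p-1)$: $g$ is Hoelder
  continuous on bounded sets, $v$ is bounded, and $|x-y|^{q-N}$ is locally integrable.
  For small $\varepsilon$ the test function must vanish, that is, $u \ge v + \varepsilon$ on $K$
  (lemmas \<open>pair_difference_estimate\<close> and \<open>strong_comparison_bounded_v\<close>). If $u$ is the bounded function, the
  argument applies to the pair $(-v,-u)$.
\<close>

section \<open>The power nonlinearity\<close>

text \<open>
  Writing $g$ as a difference of two powers of nonnegative numbers reduces its monotonicity,
  continuity and modulus of continuity to those of $s \mapsto s^{p-1}$ on $[0, \infty)$.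
\<close>

lemma gpow_alt: "gpow p a = max a 0 powr (p - 1) - max (- a) 0 powr (p - 1)"
proof -
  have *: "x powr (p - 2) * x = x powr (p - 1)" if "x \<ge> 0" for x :: real
    using that powr_add[of x "p - 2" 1] by (simp add: algebra_simps)
  show ?thesis
    using *[of a] *[of "- a"] by (auto simp: gpow_def max_def)
qed

lemma gpow_0 [simp]: "gpow p 0 = 0"
  by (simp add: gpow_def)

lemma gpow_minus: "gpow p (- a) = - gpow p a"
  by (simp add: gpow_def)

lemma abs_gpow: "\<bar>gpow p a\<bar> = \<bar>a\<bar> powr (p - 1)"
  by (auto simp: gpow_alt max_def)

lemma continuous_on_gpow:
  assumes "1 < p"
  shows "continuous_on S (gpow p)"
  unfolding gpow_alt[abs_def] using assms
  by (intro continuous_intros continuous_on_powr') auto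

lemma borel_measurable_gpow [measurable]: "gpow p \<in> borel_measurable borel"
  unfolding gpow_def[abs_def] by measurable

lemma gpow_strict_mono:
  assumes "1 < p" "a < b"
  shows "gpow p a < gpow p b"
proof (cases "0 < b")
  case True
  then have "max a 0 powr (p - 1) < max b 0 powr (p - 1)"
    using assms by (intro powr_less_mono2) auto
  moreover have "max (- b) 0 powr (p - 1) \<le> max (- a) 0 powr (p - 1)"
    using assms by (intro powr_mono2) auto
  ultimately show ?thesis by (simp add: gpow_alt)
next
  case False
  then have "max (- b) 0 powr (p - 1) < max (- a) 0 powr (p - 1)"
    using assms by (intro powr_less_mono2) auto
  moreover have "max a 0 powr (p - 1) \<le> max b 0 powr (p - 1)"
    using assms by (intro powr_mono2) auto
  ultimately show ?thesis by (simp add: gpow_alt)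
qed

lemma gpow_mono:
  assumes "1 < p" "a \<le> b"
  shows "gpow p a \<le> gpow p b"
  using gpow_strict_mono[OF assms(1), of a b] assms(2) by (cases "a = b") auto

text \<open>
  The form in which monotonicity is used: $s$ is a difference of values of a function
  that increases with the argument of $g$, so it has the sign of $a - b$.
\<close>

lemma gpow_diff_mult_nonneg:
  assumes "1 < p" "a \<le> b \<Longrightarrow> s \<le> 0" "b \<le> a \<Longrightarrow> 0 \<le> s"
  shows "0 \<le> (gpow p a - gpow p b) * s"
proof (cases "a \<le> b")
  case True
  then show ?thesis using assms gpow_mono[of p a b] by (intro mult_nonpos_nonpos) auto
next
  case False
  then show ?thesis using assms gpow_mono[of p b a] by (intro mult_nonneg_nonneg) auto
qed

text \<open>
  For exponents at most $1$ the power is subadditive, because $x \le x^r$ on $[0,1]$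
  applies to the two fractions $s/t$ and $(t-s)/t$, which add up to $1$.
\<close>

lemma powr_diff_le_powr:
  fixes s t r :: real
  assumes "0 < r" "r \<le> 1" "0 \<le> s" "s \<le> t"
  shows "t powr r - s powr r \<le> (t - s) powr r"
proof (cases "t = 0")
  case False
  have *: "x \<le> x powr r" if "0 \<le> x" "x \<le> 1" for x
    using powr_mono'[of r 1 x] assms that by simp
  have t: "t > 0" using False assms by simp
  have "1 = s / t + (t - s) / t" using t by (simp add: field_simps)
  also have "\<dots> \<le> (s / t) powr r + ((t - s) / t) powr r"
    using assms t by (intro add_mono *) auto
  also have "\<dots> = (s powr r + (t - s) powr r) / t powr r"
    using assms t by (simp add: powr_divide add_divide_distrib)
  finally show ?thesis using t by (simp add: field_simps)
qed (use assms in simp)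

lemma powr_diff_le_linear:
  fixes s t r B :: real
  assumes "1 \<le> r" "0 \<le> s" "s \<le> t" "t \<le> B"
  shows "t powr r - s powr r \<le> r * B powr (r - 1) * (t - s)"
proof (cases "s = 0 \<or> s = t")
  case True
  have "t powr r = t powr (r - 1) * t"
    using powr_add[of t "r - 1" 1] assms by simp
  also have "\<dots> \<le> (r * B powr (r - 1)) * t"
  proof (rule mult_right_mono)
    have "t powr (r - 1) \<le> 1 * B powr (r - 1)"
      using assms by (simp add: powr_mono2)
    also have "\<dots> \<le> r * B powr (r - 1)"
      using assms by (intro mult_right_mono) auto
    finally show "t powr (r - 1) \<le> r * B powr (r - 1)" .
  qed (use assms in auto)
  finally show ?thesis using True assms by auto
next
  case False
  then have st: "0 < s" "s < t" using assms by auto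
  have d: "((\<lambda>x. x powr r) has_real_derivative r * x powr (r - 1)) (at x)"
    if "s \<le> x" for x
    using that st by (intro has_real_derivative_powr) auto
  obtain z where z: "s < z" "z < t" "t powr r - s powr r = (t - s) * (r * z powr (r - 1))"
    using MVT2[of s t "\<lambda>x. x powr r" "\<lambda>x. r * x powr (r - 1)"] st d by auto
  have "z powr (r - 1) \<le> B powr (r - 1)"
    using z st assms by (intro powr_mono2) auto
  then have "(t - s) * (r * z powr (r - 1)) \<le> (t - s) * (r * B powr (r - 1))"
    using st assms by (intro mult_left_mono) auto
  then show ?thesis using z(3) by (simp add: mult_ac)
qed

lemma powr_hoelder:
  fixes r B :: real
  assumes "0 < r"
  obtains H where "0 \<le> H"
    "\<And>s t. 0 \<le> s \<Longrightarrow> 0 \<le> t \<Longrightarrow> s \<le> B \<Longrightarrow> t \<le> B \<Longrightarrow>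
       \<bar>s powr r - t powr r\<bar> \<le> H * \<bar>s - t\<bar> powr min 1 r"
proof
  show "0 \<le> 1 + r * \<bar>B\<bar> powr (r - 1)" using assms by simp
next
  fix s t :: real
  have *: "t powr r - s powr r \<le> (1 + r * \<bar>B\<bar> powr (r - 1)) * (t - s) powr min 1 r"
    if st: "0 \<le> s" "s \<le> t" "t \<le> B" for s t
  proof (cases "r \<le> 1")
    case True
    then have "t powr r - s powr r \<le> 1 * (t - s) powr min 1 r"
      using powr_diff_le_powr[of r s t] assms st by simp
    also have "\<dots> \<le> (1 + r * \<bar>B\<bar> powr (r - 1)) * (t - s) powr min 1 r"
      using assms by (intro mult_right_mono) auto
    finally show ?thesis .
  next
    case False
    then have "t powr r - s powr r \<le> (r * \<bar>B\<bar> powr (r - 1)) * (t - s)"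
      using powr_diff_le_linear[of r s t "\<bar>B\<bar>"] assms st by auto
    also have "\<dots> \<le> (1 + r * \<bar>B\<bar> powr (r - 1)) * (t - s)"
      using st by (intro mult_right_mono) auto
    finally show ?thesis using False st by simp
  qed
  assume "0 \<le> s" "0 \<le> t" "s \<le> B" "t \<le> B"
  then show "\<bar>s powr r - t powr r\<bar> \<le> (1 + r * \<bar>B\<bar> powr (r - 1)) * \<bar>s - t\<bar> powr min 1 r"
    using *[of s t] *[of t s] assms
      powr_mono2[of r s t] powr_mono2[of r t s]
    by (cases "s \<le> t") auto
qed

text \<open>
  On bounded sets $g$ is Hoelder continuous with exponent $\min(1, p-1)$. For $p > 2$ the
  constant has to grow with $B$.
\<close>

lemma gpow_hoelder:
  fixes p B :: real
  assumes "1 < p"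
  obtains H where "0 \<le> H"
    "\<And>a b. \<bar>a\<bar> \<le> B \<Longrightarrow> \<bar>b\<bar> \<le> B \<Longrightarrow> \<bar>gpow p a - gpow p b\<bar> \<le> H * \<bar>a - b\<bar> powr min 1 (p - 1)"
proof -
  define q where "q = min 1 (p - 1)"
  have q: "q > 0" using assms by (simp add: q_def)
  obtain H where H: "0 \<le> H"
    "\<And>s t. 0 \<le> s \<Longrightarrow> 0 \<le> t \<Longrightarrow> s \<le> B \<Longrightarrow> t \<le> B \<Longrightarrow>
       \<bar>s powr (p - 1) - t powr (p - 1)\<bar> \<le> H * \<bar>s - t\<bar> powr q"
    using powr_hoelder[of "p - 1" B] assms unfolding q_def by auto
  show ?thesis
  proof
    show "0 \<le> 2 * H" using H by simp
    fix a b :: real assume ab: "\<bar>a\<bar> \<le> B" "\<bar>b\<bar> \<le> B"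
    have *: "\<bar>max a 0 powr (p - 1) - max b 0 powr (p - 1)\<bar> \<le> H * \<bar>a - b\<bar> powr q"
      if "\<bar>a\<bar> \<le> B" "\<bar>b\<bar> \<le> B" for a b
    proof -
      have "\<bar>max a 0 powr (p - 1) - max b 0 powr (p - 1)\<bar> \<le> H * \<bar>max a 0 - max b 0\<bar> powr q"
        using that by (intro H(2)) auto
      also have "\<dots> \<le> H * \<bar>a - b\<bar> powr q"
        using H q by (intro mult_left_mono powr_mono2) auto
      finally show ?thesis .
    qed
    have "\<bar>max (- a) 0 powr (p - 1) - max (- b) 0 powr (p - 1)\<bar> \<le> H * \<bar>- a - - b\<bar> powr q"
      by (rule *) (use ab in auto)
    also have "\<bar>- a - - b\<bar> = \<bar>a - b\<bar>" by linarith
    finally have neg: "\<bar>max (- a) 0 powr (p - 1) - max (- b) 0 powr (p - 1)\<bar> \<le> H * \<bar>a - b\<bar> powr q" .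
    have pos: "\<bar>max a 0 powr (p - 1) - max b 0 powr (p - 1)\<bar> \<le> H * \<bar>a - b\<bar> powr q"
      by (rule *) (use ab in auto)
    have "\<bar>gpow p a - gpow p b\<bar> \<le> \<bar>max a 0 powr (p - 1) - max b 0 powr (p - 1)\<bar>
        + \<bar>max (- a) 0 powr (p - 1) - max (- b) 0 powr (p - 1)\<bar>"
      unfolding gpow_alt by arith
    also have "\<dots> \<le> 2 * H * \<bar>a - b\<bar> powr q" using pos neg by simp
    finally have "\<bar>gpow p a - gpow p b\<bar> \<le> 2 * H * \<bar>a - b\<bar> powr q" .
    then show "\<bar>gpow p a - gpow p b\<bar> \<le> 2 * H * \<bar>a - b\<bar> powr min 1 (p - 1)"
      by (simp add: q_def)
  qed
qed

text \<open>
  A lower bound for the increments of $g$ over steps of length at least $\delta$, uniform on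
  a bounded set: by monotonicity the step may be taken equal to $\delta$, and a continuous positive
  function has a positive minimum on a compact interval. For $p < 2$ the bound degenerates as $B \to \infty$.
\<close>

lemma gpow_gap:
  fixes p B \<delta> :: real
  assumes "1 < p" "0 < \<delta>"
  obtains \<eta> where "0 < \<eta>"
    "\<And>a b. \<bar>a\<bar> \<le> B \<Longrightarrow> b \<le> a - \<delta> \<Longrightarrow> \<eta> \<le> gpow p a - gpow p b"
proof -
  define B' where "B' = \<bar>B\<bar>"
  have "continuous_on {-B'..B'} (\<lambda>a. gpow p a - gpow p (a - \<delta>))"
    using assms
    by (intro continuous_intros continuous_on_gpow
        continuous_on_compose2[OF continuous_on_gpow[of p UNIV]]) auto
  moreover have "{-B'..B'} \<noteq> {}" by (simp add: B'_def)
  ultimately obtain x where x: "x \<in> {-B'..B'}"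
    "\<forall>y\<in>{-B'..B'}. gpow p x - gpow p (x - \<delta>) \<le> gpow p y - gpow p (y - \<delta>)"
    using continuous_attains_inf[OF compact_Icc] by blast
  show ?thesis
  proof
    show "0 < gpow p x - gpow p (x - \<delta>)"
      using gpow_strict_mono[of p "x - \<delta>" x] assms by simp
    fix a b :: real assume "\<bar>a\<bar> \<le> B" "b \<le> a - \<delta>"
    then show "gpow p x - gpow p (x - \<delta>) \<le> gpow p a - gpow p b"
      using x(2)[rule_format, of a] gpow_mono[of p b "a - \<delta>"] assms
      by (force simp: B'_def)
  qed
qed

text \<open>
  A form of Young's inequality; it makes all the integrals of the bilinear form converge.
\<close>

lemma gpow_mult_le:
  assumes "1 < p"
  shows "\<bar>gpow p a * b\<bar> \<le> \<bar>a\<bar> powr p + \<bar>b\<bar> powr p"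
proof -
  define m where "m = max \<bar>a\<bar> \<bar>b\<bar>"
  have "\<bar>gpow p a * b\<bar> = \<bar>a\<bar> powr (p - 1) * \<bar>b\<bar>"
    by (simp add: abs_mult abs_gpow)
  also have "\<dots> \<le> m powr (p - 1) * m"
    using assms by (intro mult_mono powr_mono2) (auto simp: m_def)
  also have "\<dots> = m powr p"
    using powr_add[of m "p - 1" 1] by (simp add: m_def)
  also have "\<dots> \<le> \<bar>a\<bar> powr p + \<bar>b\<bar> powr p"
    by (auto simp: m_def max_def)
  finally show ?thesis .
qed

lemma powr_le_add_powr:
  fixes a b c p :: real
  assumes "0 \<le> p" "\<bar>a\<bar> \<le> \<bar>b\<bar> + \<bar>c\<bar>"
  shows "\<bar>a\<bar> powr p \<le> 2 powr p * (\<bar>b\<bar> powr p + \<bar>c\<bar> powr p)"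
proof -
  define m where "m = max \<bar>b\<bar> \<bar>c\<bar>"
  have "\<bar>a\<bar> powr p \<le> (2 * m) powr p"
    using assms by (intro powr_mono2) (auto simp: m_def)
  also have "\<dots> = 2 powr p * m powr p"
    by (simp add: powr_mult m_def)
  also have "\<dots> \<le> 2 powr p * (\<bar>b\<bar> powr p + \<bar>c\<bar> powr p)"
    by (intro mult_left_mono) (auto simp: m_def max_def)
  finally show ?thesis .
qed

section \<open>The critical kernel and the energy space\<close>

lemma sigma_finite_lebesgue: "sigma_finite_measure (lebesgue :: 'a::euclidean_space measure)"
proof
  obtain A :: "'a set set" where A: "countable A" "A \<subseteq> sets lborel" "\<Union>A = space lborel"
      "\<forall>a\<in>A. emeasure lborel a \<noteq> \<infinity>"
    using lborel.sigma_finite_countable by auto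
  then show "\<exists>A::'a set set. countable A \<and> A \<subseteq> sets lebesgue \<and> \<Union>A = space lebesgue \<and>
      (\<forall>a\<in>A. emeasure lebesgue a \<noteq> \<infinity>)"
    by (intro exI[of _ A]) (auto simp: subset_iff)
qed

interpretation lebesgue: sigma_finite_measure "lebesgue :: 'a::euclidean_space measure"
  by (rule sigma_finite_lebesgue)

interpretation lebesgue_pair:
  pair_sigma_finite "lebesgue :: 'a::euclidean_space measure" "lebesgue :: 'b::euclidean_space measure" ..

abbreviation lebesgue2 :: "('a::euclidean_space \<times> 'a) measure" where
  "lebesgue2 \<equiv> lebesgue \<Otimes>\<^sub>M lebesgue"

lemma fst_lebesgue_borel [measurable]:
  "fst \<in> borel_measurable lebesgue2"
  by (rule measurable_compose[OF measurable_fst]) (intro measurable_completion, simp)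

lemma snd_lebesgue_borel [measurable]:
  "snd \<in> borel_measurable lebesgue2"
  by (rule measurable_compose[OF measurable_snd]) (intro measurable_completion, simp)

text \<open>
  On the diagonal, a null set, this takes the value $0$.
\<close>

definition kern :: "'a::euclidean_space \<Rightarrow> 'a \<Rightarrow> real" where
  "kern x y = 1 / norm (x - y) ^ DIM('a)"

lemma kern_nonneg [simp]: "0 \<le> kern x y"
  by (simp add: kern_def)

lemma kern_commute: "kern x y = kern y x"
  by (simp add: kern_def norm_minus_commute)

lemma borel_measurable_kern [measurable]:
  "(\<lambda>z. kern (fst z) (snd z)) \<in> borel_measurable lebesgue2"
  "(\<lambda>y. kern x y) \<in> borel_measurable lebesgue"
proof -
  show "(\<lambda>z. kern (fst z) (snd z)) \<in> borel_measurable lebesgue2"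
    unfolding kern_def by measurable
  have "(\<lambda>y. kern x y) \<in> borel_measurable lborel"
    unfolding kern_def by measurable
  then show "(\<lambda>y. kern x y) \<in> borel_measurable lebesgue"
    by (rule measurable_completion)
qed

lemma kern_le:
  fixes x y :: "'a::euclidean_space"
  assumes "0 < r" "r \<le> norm (x - y)"
  shows "kern x y \<le> 1 / r ^ DIM('a)"
  unfolding kern_def using assms by (intro divide_left_mono power_mono mult_pos_pos zero_less_power) auto

definition near :: "'a::euclidean_space \<times> 'a \<Rightarrow> real" where
  "near = indicator {z. norm (fst z - snd z) < 1}"

lemma near_cases: "near z = 0 \<or> near z = 1"
  by (simp add: near_def indicator_def)

lemma borel_measurable_near [measurable]: "near \<in> borel_measurable lebesgue2"
  unfolding near_def by measurable

lemma AE_pair_lebesgueI: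
  assumes "AE x in lebesgue. P x"
  shows "AE z in lebesgue2. P (fst z) \<and> P (snd z)"
proof -
  from assms obtain N where N: "{x. \<not> P x} \<subseteq> N" "N \<in> sets lebesgue" "emeasure lebesgue N = 0"
    by (auto elim!: AE_E)
  then have n: "AE x in lebesgue. x \<notin> N" by (intro AE_not_in) auto
  have [measurable]: "N \<in> sets lebesgue" by fact
  have "AE z in lebesgue2. fst z \<notin> N \<and> snd z \<notin> N"
  proof (rule lebesgue_pair.AE_pair_measure)
    show "{z \<in> space lebesgue2. fst z \<notin> N \<and> snd z \<notin> N} \<in> sets lebesgue2"
      by measurable
    show "AE x in lebesgue. AE y in lebesgue. fst (x, y) \<notin> N \<and> snd (x, y) \<notin> N"
      using n by eventually_elim (use n in simp)
  qed
  then show ?thesis by eventually_elim (use N in auto)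
qed

lemma integrable_mult_pair:
  fixes f g :: "'a::euclidean_space \<Rightarrow> real"
  assumes f [measurable]: "integrable lebesgue f" and g [measurable]: "integrable lebesgue g"
  shows "integrable lebesgue2 (\<lambda>z. f (fst z) * g (snd z))"
    and "(LINT z|lebesgue2. f (fst z) * g (snd z)) = integral\<^sup>L lebesgue f * integral\<^sup>L lebesgue g"
proof -
  show i: "integrable lebesgue2 (\<lambda>z. f (fst z) * g (snd z))"
    by (rule lebesgue_pair.Fubini_integrable) (use f g in \<open>auto simp: abs_mult\<close>)
  show "(LINT z|lebesgue2. f (fst z) * g (snd z)) = integral\<^sup>L lebesgue f * integral\<^sup>L lebesgue g"
    using lebesgue_pair.integral_fst'[OF i] by simp
qed

lemma pair_swap_lebesgue:
  fixes f :: "'a::euclidean_space \<times> 'a \<Rightarrow> real"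
  shows "integrable lebesgue2 f \<Longrightarrow> integrable lebesgue2 (\<lambda>z. f (snd z, fst z))"
    and "f \<in> borel_measurable lebesgue2 \<Longrightarrow>
     (LINT z|lebesgue2. f (snd z, fst z)) = integral\<^sup>L lebesgue2 f"
  using lebesgue_pair.integrable_product_swap[of f] lebesgue_pair.integral_product_swap[of f]
  by (simp_all add: case_prod_unfold)

abbreviation near_energy :: "real \<Rightarrow> ('a::euclidean_space \<Rightarrow> real) \<Rightarrow> 'a \<times> 'a \<Rightarrow> real" where
  "near_energy p u z \<equiv> near z * (\<bar>u (fst z) - u (snd z)\<bar> powr p * kern (fst z) (snd z))"

text \<open>
  Tonelli turns the iterated energy into integrability over the product space.
\<close>

lemma X0_iff:
  fixes u :: "'a::euclidean_space \<Rightarrow> real"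
  shows "u \<in> X0 p \<Omega> \<longleftrightarrow> u \<in> borel_measurable lebesgue \<and> integrable lebesgue (\<lambda>x. \<bar>u x\<bar> powr p)
     \<and> (AE x in lebesgue. x \<notin> \<Omega> \<longrightarrow> u x = 0) \<and> integrable lebesgue2 (near_energy p u)"
proof -
  have "(\<integral>\<^sup>+ x. (\<integral>\<^sup>+ y\<in>ball x 1. ennreal (\<bar>u x - u y\<bar> powr p / norm (x - y) ^ DIM('a)) \<partial>lebesgue) \<partial>lebesgue) < \<infinity>
      \<longleftrightarrow> integrable lebesgue2 (near_energy p u)"
    if [measurable]: "u \<in> borel_measurable lebesgue"
  proof -
    have "(\<integral>\<^sup>+ x. (\<integral>\<^sup>+ y\<in>ball x 1. ennreal (\<bar>u x - u y\<bar> powr p / norm (x - y) ^ DIM('a)) \<partial>lebesgue) \<partial>lebesgue)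
       = (\<integral>\<^sup>+ x. (\<integral>\<^sup>+ y. ennreal (near_energy p u (x, y)) \<partial>lebesgue) \<partial>lebesgue)"
      by (intro nn_integral_cong) (auto simp: near_def kern_def dist_norm split: split_indicator)
    also have "\<dots> = (\<integral>\<^sup>+ z. ennreal (near_energy p u z) \<partial>lebesgue2)"
      by (rule lebesgue.nn_integral_fst) measurable
    also have "\<dots> = (\<integral>\<^sup>+ z. ennreal (norm (near_energy p u z)) \<partial>lebesgue2)"
      by (intro nn_integral_cong) (auto simp: near_def split: split_indicator)
    finally show ?thesis
      by (simp add: integrable_iff_bounded)
  qed
  then show ?thesis unfolding X0_def by blast
qed

text \<open>
  The space is stable under every operation that does not increase the values and the
  differences of its arguments by more than their sum, in particular under differences and
  positive parts; the test functions below arise in this way from $u$, $v$ and a Lipschitz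
  cutoff.
\<close>

lemma X0_dominated:
  fixes u v w :: "'a::euclidean_space \<Rightarrow> real"
  assumes u: "u \<in> X0 p \<Omega>" and v: "v \<in> X0 p \<Omega>" and p: "0 \<le> p"
    and w [measurable]: "w \<in> borel_measurable lebesgue"
    and 1: "\<And>x. \<bar>w x\<bar> \<le> \<bar>u x\<bar> + \<bar>v x\<bar>"
    and 2: "\<And>x y. \<bar>w x - w y\<bar> \<le> \<bar>u x - u y\<bar> + \<bar>v x - v y\<bar>"
  shows "w \<in> X0 p \<Omega>"
proof -
  note U = u[unfolded X0_iff] and V = v[unfolded X0_iff]
  have "integrable lebesgue (\<lambda>x. \<bar>w x\<bar> powr p)"
  proof (rule Bochner_Integration.integrable_bound)
    show "integrable lebesgue (\<lambda>x. 2 powr p * (\<bar>u x\<bar> powr p + \<bar>v x\<bar> powr p))"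
      using U V by auto
    show "AE x in lebesgue. norm (\<bar>w x\<bar> powr p) \<le> norm (2 powr p * (\<bar>u x\<bar> powr p + \<bar>v x\<bar> powr p))"
      using powr_le_add_powr[OF p 1] by simp
  qed measurable
  moreover have "AE x in lebesgue. x \<notin> \<Omega> \<longrightarrow> w x = 0"
  proof -
    have "AE x in lebesgue. x \<notin> \<Omega> \<longrightarrow> u x = 0" "AE x in lebesgue. x \<notin> \<Omega> \<longrightarrow> v x = 0"
      using U V by auto
    then show ?thesis
    proof eventually_elim
      case (elim x)
      then show ?case using 1[of x] by auto
    qed
  qed
  moreover have "integrable lebesgue2 (near_energy p w)"
  proof (rule Bochner_Integration.integrable_bound)
    show "integrable lebesgue2 (\<lambda>z. 2 powr p * (near_energy p u z + near_energy p v z))"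
      using U V by auto
    show "AE z in lebesgue2. norm (near_energy p w z)
        \<le> norm (2 powr p * (near_energy p u z + near_energy p v z))"
    proof (intro AE_I2)
      fix z :: "'a \<times> 'a"
      have "near z * kern (fst z) (snd z) * \<bar>w (fst z) - w (snd z)\<bar> powr p
        \<le> near z * kern (fst z) (snd z) *
          (2 powr p * (\<bar>u (fst z) - u (snd z)\<bar> powr p + \<bar>v (fst z) - v (snd z)\<bar> powr p))"
        using powr_le_add_powr[OF p 2[of "fst z" "snd z"]]
        by (intro mult_left_mono) (auto simp: near_def)
      then show "norm (near_energy p w z) \<le> norm (2 powr p * (near_energy p u z + near_energy p v z))"
        using near_cases[of z] by (auto simp: algebra_simps)
    qed
  qed measurable
  ultimately show ?thesis by (simp add: X0_iff)
qed

lemma X0_uminus: "u \<in> X0 p \<Omega> \<Longrightarrow> (\<lambda>x. - u x) \<in> X0 p \<Omega>"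
  by (simp add: X0_iff abs_minus_commute)

section \<open>The regional form of the bilinear form\<close>

abbreviation inside2 :: "'a::euclidean_space set \<Rightarrow> 'a \<times> 'a \<Rightarrow> real" where
  "inside2 \<Omega> z \<equiv> indicator \<Omega> (fst z) * indicator \<Omega> (snd z)"

definition pair_form :: "real \<Rightarrow> ('a::euclidean_space \<Rightarrow> real) \<Rightarrow> ('a \<Rightarrow> real) \<Rightarrow> 'a \<times> 'a \<Rightarrow> real" where
  "pair_form p u \<phi> z =
     gpow p (u (fst z) - u (snd z)) * (\<phi> (fst z) - \<phi> (snd z)) * kern (fst z) (snd z)"

lemma borel_measurable_pair_form [measurable]:
  assumes [measurable]: "u \<in> borel_measurable lebesgue" "\<phi> \<in> borel_measurable lebesgue"
  shows "pair_form p u \<phi> \<in> borel_measurable lebesgue2"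
  unfolding pair_form_def by measurable

lemma abs_pair_form:
  "\<bar>pair_form p u \<phi> z\<bar> =
     \<bar>gpow p (u (fst z) - u (snd z)) * (\<phi> (fst z) - \<phi> (snd z))\<bar> * kern (fst z) (snd z)"
  by (simp add: pair_form_def abs_mult)

lemma integrable_gpow_mult:
  fixes u \<phi> :: "'a::euclidean_space \<Rightarrow> real"
  assumes p: "1 < p" and u: "u \<in> X0 p \<Omega>" and \<phi>: "\<phi> \<in> X0 p \<Omega>"
  shows "integrable lebesgue (\<lambda>x. gpow p (u x) * \<phi> x)"
proof (rule Bochner_Integration.integrable_bound)
  note U = u[unfolded X0_iff] \<phi>[unfolded X0_iff]
  show "integrable lebesgue (\<lambda>x. \<bar>u x\<bar> powr p + \<bar>\<phi> x\<bar> powr p)" using U by auto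
  have [measurable]: "u \<in> borel_measurable lebesgue" "\<phi> \<in> borel_measurable lebesgue" using U by auto
  show "(\<lambda>x. gpow p (u x) * \<phi> x) \<in> borel_measurable lebesgue" by measurable
  show "AE x in lebesgue. norm (gpow p (u x) * \<phi> x) \<le> norm (\<bar>u x\<bar> powr p + \<bar>\<phi> x\<bar> powr p)"
    using gpow_mult_le[OF p] by simp
qed

lemma integrable_near_pair_form:
  fixes u \<phi> :: "'a::euclidean_space \<Rightarrow> real"
  assumes p: "1 < p" and u: "u \<in> X0 p \<Omega>" and \<phi>: "\<phi> \<in> X0 p \<Omega>"
  shows "integrable lebesgue2 (\<lambda>z. near z * pair_form p u \<phi> z)"
proof (rule Bochner_Integration.integrable_bound)
  note U = u[unfolded X0_iff] \<phi>[unfolded X0_iff]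
  show "integrable lebesgue2 (\<lambda>z. near_energy p u z + near_energy p \<phi> z)" using U by auto
  have [measurable]: "u \<in> borel_measurable lebesgue" "\<phi> \<in> borel_measurable lebesgue" using U by auto
  show "(\<lambda>z. near z * pair_form p u \<phi> z) \<in> borel_measurable lebesgue2" by measurable
  show "AE z in lebesgue2. norm (near z * pair_form p u \<phi> z) \<le> norm (near_energy p u z + near_energy p \<phi> z)"
  proof (intro AE_I2)
    fix z :: "'a \<times> 'a"
    have "\<bar>gpow p (u (fst z) - u (snd z)) * (\<phi> (fst z) - \<phi> (snd z))\<bar> * kern (fst z) (snd z)
      \<le> (\<bar>u (fst z) - u (snd z)\<bar> powr p + \<bar>\<phi> (fst z) - \<phi> (snd z)\<bar> powr p) * kern (fst z) (snd z)"
      by (intro mult_right_mono gpow_mult_le p) auto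
    then show "norm (near z * pair_form p u \<phi> z) \<le> norm (near_energy p u z + near_energy p \<phi> z)"
      unfolding abs_pair_form[symmetric] using near_cases[of z] by (auto simp: algebra_simps)
  qed
qed

lemma kern_le_1_far: "(1 - near (x, y)) * kern x y \<le> 1"
  using kern_le[of 1 x y] by (auto simp: near_def split: split_indicator)

lemma integrable_indicator_bounded:
  fixes \<Omega> :: "'a::euclidean_space set"
  assumes "\<Omega> \<in> sets lebesgue" "bounded \<Omega>"
  shows "integrable lebesgue (indicator \<Omega> :: 'a \<Rightarrow> real)"
proof (rule integrable_real_indicator)
  have "\<Omega> \<in> lmeasurable" using assms by (rule bounded_set_imp_lmeasurable[rotated])
  then show "emeasure lebesgue \<Omega> < \<infinity>" by (auto simp: fmeasurable_def)
qed fact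

lemma integrable_far_pair_form:
  fixes u \<phi> :: "'a::euclidean_space \<Rightarrow> real"
  assumes p: "1 < p" and u: "u \<in> X0 p \<Omega>" and \<phi>: "\<phi> \<in> X0 p \<Omega>"
    and \<Omega> [measurable]: "\<Omega> \<in> sets lebesgue" and b: "bounded \<Omega>"
  shows "integrable lebesgue2 (\<lambda>z. (1 - near z) * inside2 \<Omega> z * pair_form p u \<phi> z)"
proof (rule Bochner_Integration.integrable_bound)
  note U = u[unfolded X0_iff] \<phi>[unfolded X0_iff]
  define e where "e = (\<lambda>x. \<bar>u x\<bar> powr p + \<bar>\<phi> x\<bar> powr p)"
  have e: "integrable lebesgue e" using U by (auto simp: e_def)
  have e0: "0 \<le> e x" for x by (simp add: e_def)
  have i1: "integrable lebesgue2 (\<lambda>z. e (fst z) * indicator \<Omega> (snd z))"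
    by (rule integrable_mult_pair(1)[OF e integrable_indicator_bounded[OF \<Omega> b]])
  have i2: "integrable lebesgue2 (\<lambda>z. indicator \<Omega> (fst z) * e (snd z))"
    by (rule integrable_mult_pair(1)[OF integrable_indicator_bounded[OF \<Omega> b] e])
  show "integrable lebesgue2 (\<lambda>z. 2 powr p * (e (fst z) * indicator \<Omega> (snd z) + indicator \<Omega> (fst z) * e (snd z)))"
    using i1 i2 by auto
  have [measurable]: "u \<in> borel_measurable lebesgue" "\<phi> \<in> borel_measurable lebesgue" using U by auto
  show "(\<lambda>z. (1 - near z) * inside2 \<Omega> z * pair_form p u \<phi> z) \<in> borel_measurable lebesgue2" by measurable
  show "AE z in lebesgue2. norm ((1 - near z) * inside2 \<Omega> z * pair_form p u \<phi> z)
    \<le> norm (2 powr p * (e (fst z) * indicator \<Omega> (snd z) + indicator \<Omega> (fst z) * e (snd z)))"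
  proof (intro AE_I2)
    fix z :: "'a \<times> 'a"
    obtain x y where z: "z = (x, y)" by force
    have "\<bar>gpow p (u x - u y) * (\<phi> x - \<phi> y)\<bar> \<le> \<bar>u x - u y\<bar> powr p + \<bar>\<phi> x - \<phi> y\<bar> powr p"
      by (intro gpow_mult_le p)
    also have "\<dots> \<le> 2 powr p * (\<bar>u x\<bar> powr p + \<bar>u y\<bar> powr p) + 2 powr p * (\<bar>\<phi> x\<bar> powr p + \<bar>\<phi> y\<bar> powr p)"
      using p by (intro add_mono powr_le_add_powr) auto
    also have "\<dots> = 2 powr p * (e x + e y)" by (simp add: e_def algebra_simps)
    finally have "((1 - near z) * kern x y) * \<bar>gpow p (u x - u y) * (\<phi> x - \<phi> y)\<bar> \<le> 1 * (2 powr p * (e x + e y))"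
      using kern_le_1_far near_cases[of "(x, y)"] z by (intro mult_mono) auto
    moreover have "\<bar>pair_form p u \<phi> z\<bar> = \<bar>gpow p (u x - u y) * (\<phi> x - \<phi> y)\<bar> * kern x y"
      by (simp add: abs_pair_form z)
    ultimately have "(1 - near z) * \<bar>pair_form p u \<phi> z\<bar> \<le> 2 powr p * (e x + e y)"
      by (simp only: mult_ac mult_1_left)
    then show "norm ((1 - near z) * inside2 \<Omega> z * pair_form p u \<phi> z)
    \<le> norm (2 powr p * (e (fst z) * indicator \<Omega> (snd z) + indicator \<Omega> (fst z) * e (snd z)))"
      using near_cases[of z] e0[of x] e0[of y] z
      by (auto simp: algebra_simps split: split_indicator)
  qed
qed

lemma integrable_pair_form:
  fixes u \<phi> :: "'a::euclidean_space \<Rightarrow> real"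
  assumes p: "1 < p" and u: "u \<in> X0 p \<Omega>" and \<phi>: "\<phi> \<in> X0 p \<Omega>"
    and \<Omega> [measurable]: "\<Omega> \<in> sets lebesgue" and b: "bounded \<Omega>"
  shows "integrable lebesgue2 (\<lambda>z. inside2 \<Omega> z * pair_form p u \<phi> z)"
proof -
  have "integrable lebesgue2 (\<lambda>z. inside2 \<Omega> z * (near z * pair_form p u \<phi> z))"
  proof (rule Bochner_Integration.integrable_bound[OF integrable_near_pair_form[OF p u \<phi>]])
    have [measurable]: "u \<in> borel_measurable lebesgue" "\<phi> \<in> borel_measurable lebesgue"
      using u \<phi> by (auto simp: X0_iff)
    show "(\<lambda>z. inside2 \<Omega> z * (near z * pair_form p u \<phi> z)) \<in> borel_measurable lebesgue2" by measurable
  qed (auto split: split_indicator)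
  from Bochner_Integration.integrable_add[OF this integrable_far_pair_form[OF assms]]
  show ?thesis by (simp add: algebra_simps)
qed

text \<open>
  Integrated in the second variable and multiplied by $C_{N,p}$, this gives $h_\Omega$.
\<close>

definition h_kern :: "'a::euclidean_space set \<Rightarrow> 'a \<times> 'a \<Rightarrow> real" where
  "h_kern \<Omega> z = kern (fst z) (snd z) *
     (near z * indicator (- \<Omega>) (snd z) - (1 - near z) * indicator \<Omega> (snd z))"

lemma integrable_kern_near_outside:
  fixes \<Omega> :: "'a::euclidean_space set"
  assumes "open \<Omega>" "x \<in> \<Omega>"
  shows "set_integrable lebesgue (ball x 1 - \<Omega>) (kern x)"
proof -
  obtain r where r: "0 < r" "ball x r \<subseteq> \<Omega>"
    using assms by (meson openE)
  show ?thesis unfolding set_integrable_def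
  proof (rule Bochner_Integration.integrable_bound)
    have "ball x 1 - \<Omega> \<in> sets lebesgue" using assms by (intro sets.Diff) (auto simp: sets_completionI_sets)
    then show "integrable lebesgue (\<lambda>y. (1 / r ^ DIM('a)) * indicator (ball x 1 - \<Omega>) y :: real)"
      by (intro integrable_mult_right integrable_indicator_bounded bounded_subset[OF bounded_ball, of _ x 1]) auto
    show "(\<lambda>y. indicator (ball x 1 - \<Omega>) y *\<^sub>R kern x y) \<in> borel_measurable lebesgue"
      using \<open>ball x 1 - \<Omega> \<in> sets lebesgue\<close> by measurable
    show "AE y in lebesgue. norm (indicator (ball x 1 - \<Omega>) y *\<^sub>R kern x y)
        \<le> norm ((1 / r ^ DIM('a)) * indicator (ball x 1 - \<Omega>) y)"
    proof (intro AE_I2)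
      fix y
      have "kern x y \<le> 1 / r ^ DIM('a)" if "y \<notin> \<Omega>"
        using that r by (intro kern_le) (auto simp: dist_norm not_less[symmetric] subset_iff)
      then show "norm (indicator (ball x 1 - \<Omega>) y *\<^sub>R kern x y)
        \<le> norm ((1 / r ^ DIM('a)) * indicator (ball x 1 - \<Omega>) y)"
        using r by (auto split: split_indicator)
    qed
  qed
qed

lemma integrable_kern_far_inside:
  fixes \<Omega> :: "'a::euclidean_space set"
  assumes "open \<Omega>" "bounded \<Omega>"
  shows "set_integrable lebesgue (\<Omega> - ball x 1) (kern x)"
proof -
  have [measurable]: "\<Omega> - ball x 1 \<in> sets lebesgue" using assms by (intro sets.Diff) (auto simp: sets_completionI_sets)
  show ?thesis unfolding set_integrable_def
  proof (rule Bochner_Integration.integrable_bound)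
    show "integrable lebesgue (indicator (\<Omega> - ball x 1) :: 'a \<Rightarrow> real)"
      using assms by (intro integrable_indicator_bounded bounded_diff) auto
    show "(\<lambda>y. indicator (\<Omega> - ball x 1) y *\<^sub>R kern x y) \<in> borel_measurable lebesgue"
      by measurable
    show "AE y in lebesgue. norm (indicator (\<Omega> - ball x 1) y *\<^sub>R kern x y) \<le> norm (indicator (\<Omega> - ball x 1) y :: real)"
      using kern_le[of 1 x] by (auto simp: dist_norm split: split_indicator)
  qed
qed

lemma h_fun_eq_integral:
  fixes \<Omega> :: "'a::euclidean_space set"
  assumes "open \<Omega>" "bounded \<Omega>" "x \<in> \<Omega>"
  shows "h_fun p \<Omega> x = C_const DIM('a) p * (LINT y|lebesgue. h_kern \<Omega> (x, y))"
proof -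
  have "(LINT y|lebesgue. h_kern \<Omega> (x, y)) =
     (LINT y|lebesgue. indicator (ball x 1 - \<Omega>) y *\<^sub>R kern x y - indicator (\<Omega> - ball x 1) y *\<^sub>R kern x y)"
    by (intro Bochner_Integration.integral_cong refl)
       (auto simp: h_kern_def near_def dist_norm split: split_indicator)
  also have "\<dots> = (LINT y:ball x 1 - \<Omega>|lebesgue. kern x y) - (LINT y:\<Omega> - ball x 1|lebesgue. kern x y)"
    unfolding set_lebesgue_integral_def
    using integrable_kern_near_outside[OF assms(1,3)] integrable_kern_far_inside[OF assms(1,2), of x]
    by (intro Bochner_Integration.integral_diff) (auto simp: set_integrable_def)
  finally show ?thesis
    by (simp add: h_fun_def kern_def right_diff_distrib)
qed

text \<open>
  The form $\mathcal{E}_{L,p}$ is a double integral over $\Omega \times \Omega$ plus a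
  potential. Where exactly one of $x, y$ lies in $\Omega$, the near integrand reduces to
  $g(u(x))\varphi(x)|x-y|^{-N}$ (or to the same term with $x$ and $y$ exchanged) and the far integrand
  vanishes; where both lie in $\Omega$, the far integrand contributes two further terms of this kind
  with a minus sign. By symmetry and Fubini these one-variable terms add up to
  $\int_\Omega h_\Omega g(u) \varphi$.
\<close>

lemma E_form_regional:
  fixes u \<phi> :: "'a::euclidean_space \<Rightarrow> real"
  assumes p: "1 < p" and u: "u \<in> X0 p \<Omega>" and \<phi>: "\<phi> \<in> X0 p \<Omega>"
    and \<Omega>: "open \<Omega>" "bounded \<Omega>"
  shows "integrable lebesgue (\<lambda>x. indicator \<Omega> x * (h_fun p \<Omega> x * (gpow p (u x) * \<phi> x)))"
    and "E_form p u \<phi> = C_const DIM('a) p / 2 * (LINT z|lebesgue2. inside2 \<Omega> z * pair_form p u \<phi> z)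
       + (LINT x|lebesgue. indicator \<Omega> x * ((rho DIM('a) p + h_fun p \<Omega> x) * (gpow p (u x) * \<phi> x)))"
proof -
  note U = u[unfolded X0_iff] \<phi>[unfolded X0_iff]
  have [measurable]: "u \<in> borel_measurable lebesgue" "\<phi> \<in> borel_measurable lebesgue" using U by auto
  have [measurable]: "\<Omega> \<in> sets lebesgue" using \<Omega> by auto
  define e where "e = (\<lambda>x. gpow p (u x) * \<phi> x)"
  have e: "integrable lebesgue e" unfolding e_def by (rule integrable_gpow_mult[OF p u \<phi>])
  have [measurable]: "e \<in> borel_measurable lebesgue" using e by auto
  \<comment> \<open>all the terms that involve only the values at the first point\<close>
  define a where "a = (\<lambda>z. indicator \<Omega> (fst z) * e (fst z) * h_kern \<Omega> z)"
  have zero: "AE z in lebesgue2. (fst z \<notin> \<Omega> \<longrightarrow> u (fst z) = 0 \<and> \<phi> (fst z) = 0) \<and>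
     (snd z \<notin> \<Omega> \<longrightarrow> u (snd z) = 0 \<and> \<phi> (snd z) = 0)"
    by (rule AE_pair_lebesgueI) (use U in auto)
  have in_G: "integrable lebesgue2 (\<lambda>z. near z * pair_form p u \<phi> z)"
    by (rule integrable_near_pair_form[OF p u \<phi>])
  have ins: "integrable lebesgue2 (\<lambda>z. inside2 \<Omega> z * pair_form p u \<phi> z)"
    by (rule integrable_pair_form[OF p u \<phi>]) (use \<Omega> in auto)
  have a_meas [measurable]: "a \<in> borel_measurable lebesgue2"
    unfolding a_def h_kern_def by measurable
  have a: "integrable lebesgue2 a"
  proof (rule Bochner_Integration.integrable_bound)
    show "integrable lebesgue2 (\<lambda>z. \<bar>near z * pair_form p u \<phi> z\<bar> + \<bar>e (fst z)\<bar> * indicator \<Omega> (snd z))"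
      using in_G integrable_mult_pair(1)[of "\<lambda>x. \<bar>e x\<bar>", OF _ integrable_indicator_bounded[of \<Omega>]] e \<Omega>
      by auto
    show "AE z in lebesgue2. norm (a z) \<le> norm (\<bar>near z * pair_form p u \<phi> z\<bar> + \<bar>e (fst z)\<bar> * indicator \<Omega> (snd z))"
      using zero
    proof eventually_elim
      case (elim z)
      obtain x y where z: "z = (x, y)" by force
      have k: "(1 - near (x, y)) * (kern x y * \<bar>e x\<bar>) \<le> \<bar>e x\<bar>"
        using mult_right_mono[OF kern_le_1_far[of x y], of "\<bar>e x\<bar>"] by (simp add: mult_ac)
      show ?case
        using elim k near_cases[of z] unfolding z a_def h_kern_def pair_form_def e_def
        by (auto simp: abs_mult mult_ac split: split_indicator)
    qed
  qed measurable
  have a': "integrable lebesgue2 (\<lambda>z. a (snd z, fst z))"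
    by (rule pair_swap_lebesgue(1)[OF a])
  have inner: "(LINT y|lebesgue. a (x, y)) * C_const DIM('a) p = indicator \<Omega> x * (h_fun p \<Omega> x * e x)" for x
    by (cases "x \<in> \<Omega>") (auto simp: a_def h_fun_eq_integral[OF \<Omega>])
  have int_a: "C_const DIM('a) p * integral\<^sup>L lebesgue2 a = (LINT x|lebesgue. indicator \<Omega> x * (h_fun p \<Omega> x * e x))"
  proof -
    have "(LINT x|lebesgue. (LINT y|lebesgue. a (x, y)) * C_const DIM('a) p) = integral\<^sup>L lebesgue2 a * C_const DIM('a) p"
      by (simp add: lebesgue_pair.integral_fst'[OF a])
    then show ?thesis unfolding inner by (simp add: mult.commute)
  qed
  have "integrable lebesgue (\<lambda>x. (LINT y|lebesgue. a (x, y)) * C_const DIM('a) p)"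
    using lebesgue_pair.integrable_fst'[OF a] by auto
  then show i_h: "integrable lebesgue (\<lambda>x. indicator \<Omega> x * (h_fun p \<Omega> x * (gpow p (u x) * \<phi> x)))"
    by (simp add: inner e_def)
  have i_e: "integrable lebesgue (\<lambda>x. indicator \<Omega> x * e x)"
    using integrable_mult_indicator[OF _ e, of \<Omega>] by simp
  \<comment> \<open>the far integrand, and its expression through the regional integrand\<close>
  define F where "F = (\<lambda>z. (1 - near z) * (pair_form p u \<phi> z - e (fst z) * kern (fst z) (snd z) - e (snd z) * kern (fst z) (snd z)))"
  define F' where "F' = (\<lambda>z. inside2 \<Omega> z * pair_form p u \<phi> z + a z + a (snd z, fst z) - near z * pair_form p u \<phi> z)"
  have [measurable]: "F \<in> borel_measurable lebesgue2" unfolding F_def by measurable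
  have F'_int: "integrable lebesgue2 F'" unfolding F'_def using ins a a' in_G by auto
  have FF': "AE z in lebesgue2. F z = F' z"
    using zero
  proof eventually_elim
    case (elim z)
    obtain x y where z: "z = (x, y)" by force
    have n: "near (y, x) = near (x, y)" by (simp add: near_def norm_minus_commute indicator_def)
    show ?case
      using elim near_cases[of z] unfolding z F_def F'_def a_def h_kern_def pair_form_def e_def
      by (auto simp: n kern_commute[of y x] gpow_minus algebra_simps split: split_indicator)
  qed
  have "integral\<^sup>L lebesgue2 F = integral\<^sup>L lebesgue2 F'"
    using FF' F'_int by (intro integral_cong_AE) auto
  also have "\<dots> = integral\<^sup>L lebesgue2 (\<lambda>z. inside2 \<Omega> z * pair_form p u \<phi> z) + integral\<^sup>L lebesgue2 a
     + integral\<^sup>L lebesgue2 (\<lambda>z. a (snd z, fst z)) - integral\<^sup>L lebesgue2 (\<lambda>z. near z * pair_form p u \<phi> z)"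
    unfolding F'_def using ins a a' in_G by simp
  also have "integral\<^sup>L lebesgue2 (\<lambda>z. a (snd z, fst z)) = integral\<^sup>L lebesgue2 a"
    by (rule pair_swap_lebesgue(2)) measurable
  finally have int_F: "integral\<^sup>L lebesgue2 F + integral\<^sup>L lebesgue2 (\<lambda>z. near z * pair_form p u \<phi> z)
     = integral\<^sup>L lebesgue2 (\<lambda>z. inside2 \<Omega> z * pair_form p u \<phi> z) + 2 * integral\<^sup>L lebesgue2 a" by simp
  have E: "E_form p u \<phi> = C_const DIM('a) p / 2 * integral\<^sup>L lebesgue2 (\<lambda>z. near z * pair_form p u \<phi> z)
     + rho DIM('a) p * integral\<^sup>L lebesgue e + C_const DIM('a) p / 2 * integral\<^sup>L lebesgue2 F"
    unfolding E_form_def set_lebesgue_integral_def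
  proof (intro arg_cong2[where f="(+)"] arg_cong2[where f="(*)"] refl Bochner_Integration.integral_cong)
  qed (auto simp: near_def pair_form_def e_def F_def kern_def diff_divide_distrib split: split_indicator)
  have "integral\<^sup>L lebesgue e = (LINT x|lebesgue. indicator \<Omega> x * e x)"
    by (intro integral_cong_AE) (use U in \<open>auto simp: e_def split: split_indicator\<close>)
  then have "rho DIM('a) p * integral\<^sup>L lebesgue e = (LINT x|lebesgue. rho DIM('a) p * (indicator \<Omega> x * e x))"
    by (simp only: integral_mult_right_zero)
  then have "E_form p u \<phi> = C_const DIM('a) p / 2 * (integral\<^sup>L lebesgue2 F + integral\<^sup>L lebesgue2 (\<lambda>z. near z * pair_form p u \<phi> z))
     + (LINT x|lebesgue. rho DIM('a) p * (indicator \<Omega> x * e x))"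
    unfolding E by (simp only: algebra_simps)
  also have "\<dots> = C_const DIM('a) p / 2 * (LINT z|lebesgue2. inside2 \<Omega> z * pair_form p u \<phi> z)
     + ((LINT x|lebesgue. rho DIM('a) p * (indicator \<Omega> x * e x)) + (LINT x|lebesgue. indicator \<Omega> x * (h_fun p \<Omega> x * e x)))"
    unfolding int_F int_a[symmetric] by (simp add: algebra_simps)
  also have "(LINT x|lebesgue. rho DIM('a) p * (indicator \<Omega> x * e x)) + (LINT x|lebesgue. indicator \<Omega> x * (h_fun p \<Omega> x * e x))
     = (LINT x|lebesgue. rho DIM('a) p * (indicator \<Omega> x * e x) + indicator \<Omega> x * (h_fun p \<Omega> x * e x))"
    using i_e i_h by (intro Bochner_Integration.integral_add[symmetric]) (auto simp: e_def)
  also have "\<dots> = (LINT x|lebesgue. indicator \<Omega> x * ((rho DIM('a) p + h_fun p \<Omega> x) * (gpow p (u x) * \<phi> x)))"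
    by (intro Bochner_Integration.integral_cong refl) (simp add: e_def algebra_simps)
  finally show "E_form p u \<phi> = C_const DIM('a) p / 2 * (LINT z|lebesgue2. inside2 \<Omega> z * pair_form p u \<phi> z)
       + (LINT x|lebesgue. indicator \<Omega> x * ((rho DIM('a) p + h_fun p \<Omega> x) * (gpow p (u x) * \<phi> x)))" .
qed

section \<open>Unboundedness of the potential near the boundary\<close>

lemma C_const_pos: "1 < p \<Longrightarrow> 0 < C_const DIM('a::euclidean_space) p"
  unfolding C_const_def by (intro divide_pos_pos mult_pos_pos Gamma_real_pos) auto

lemma L_inf_bounded:
  fixes \<Omega> :: "'a::euclidean_space set"
  assumes "f \<in> L_inf \<Omega>" "\<Omega> \<in> sets lebesgue"
  obtains M where "0 \<le> M" "AE x in lebesgue. x \<in> \<Omega> \<longrightarrow> \<bar>f x\<bar> \<le> M"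
proof -
  have "esssup (lebesgue_on \<Omega>) (\<lambda>x. ereal \<bar>f x\<bar>) < \<infinity>"
    using assms by (simp add: L_inf_def)
  then obtain M where M: "esssup (lebesgue_on \<Omega>) (\<lambda>x. ereal \<bar>f x\<bar>) < ereal M"
    using less_PInf_Ex_of_nat by auto
  have "AE x in lebesgue_on \<Omega>. \<bar>f x\<bar> \<le> \<bar>M\<bar>"
    using esssup_AE[of "\<lambda>x. ereal \<bar>f x\<bar>" "lebesgue_on \<Omega>"]
  proof eventually_elim
    case (elim x)
    then have "ereal \<bar>f x\<bar> < ereal M" using M by (rule le_less_trans)
    then show ?case by simp
  qed
  then have "AE x in lebesgue. x \<in> \<Omega> \<longrightarrow> \<bar>f x\<bar> \<le> \<bar>M\<bar>"
    using assms(2) by (simp add: AE_restrict_space_iff)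
  then show ?thesis using that[of "\<bar>M\<bar>"] by simp
qed

lemma L_inf_measurable:
  fixes \<Omega> :: "'a::euclidean_space set"
  assumes "f \<in> L_inf \<Omega>" "\<Omega> \<in> sets lebesgue"
  shows "(\<lambda>x. indicator \<Omega> x * f x) \<in> borel_measurable lebesgue"
  using assms borel_measurable_restrict_space_iff[of \<Omega> lebesgue f]
  by (simp add: L_inf_def)

lemma L_inf_uminus: "f \<in> L_inf \<Omega> \<Longrightarrow> (\<lambda>x. - f x) \<in> L_inf \<Omega>"
  by (simp add: L_inf_def)

lemma AE_nonempty_open:
  fixes U :: "'a::euclidean_space set"
  assumes "AE x in lebesgue. P x" "open U" "U \<noteq> {}"
  obtains x where "x \<in> U" "P x"
proof -
  have "\<not> (AE x in lebesgue. x \<notin> U)"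
  proof
    assume "AE x in lebesgue. x \<notin> U"
    then have "U \<in> null_sets lebesgue"
      using assms(2) by (subst (asm) AE_iff_null_sets[symmetric]) auto
    then show False
      using open_not_negligible[OF assms(2,3)] by (simp add: negligible_iff_null_sets)
  qed
  moreover have "AE x in lebesgue. x \<notin> U" if "\<forall>x\<in>U. \<not> P x"
    using assms(1) by eventually_elim (use that in auto)
  ultimately show ?thesis using that by blast
qed

text \<open>
  Disjoint pieces of $B_1(x) \setminus \Omega$ contribute to the positive part of $h_\Omega$;
  the negative part is at most $C_{N,p}|\Omega|$ because the kernel is at most $1$ there.
\<close>

lemma h_fun_lower_bound:
  fixes \<Omega> :: "'a::euclidean_space set" and J :: nat
  assumes p: "1 < p" and \<Omega>: "open \<Omega>" "bounded \<Omega>" and x: "x \<in> \<Omega>"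
    and B [measurable]: "\<And>j. B j \<in> sets borel" and disj: "disjoint_family_on B {..<J}"
    and sub: "\<And>j y. j < J \<Longrightarrow> y \<in> B j \<Longrightarrow> y \<in> ball x 1 - \<Omega>"
    and low: "\<And>j y. j < J \<Longrightarrow> y \<in> B j \<Longrightarrow> m j \<le> kern x y"
  shows "C_const DIM('a) p * ((\<Sum>j<J. m j * measure lebesgue (B j)) - measure lebesgue \<Omega>) \<le> h_fun p \<Omega> x"
proof -
  have fin: "integrable lebesgue (\<lambda>y. m j * indicator (B j) y)" if "j < J" for j
  proof -
    have "B j \<subseteq> ball x 1" using sub[OF that] by auto
    then have "bounded (B j)" by (rule bounded_subset[OF bounded_ball])
    then show ?thesis
      by (intro integrable_mult_right integrable_indicator_bounded) (auto simp: sets_completionI_sets)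
  qed
  have "(\<Sum>j<J. m j * measure lebesgue (B j)) = (\<Sum>j<J. (LINT y|lebesgue. m j * indicator (B j) y))"
    by (intro sum.cong) (auto simp: sets_completionI_sets)
  also have "\<dots> = (LINT y|lebesgue. (\<Sum>j<J. m j * indicator (B j) y))"
    using fin by (intro Bochner_Integration.integral_sum[symmetric]) auto
  also have "\<dots> \<le> (LINT y:ball x 1 - \<Omega>|lebesgue. kern x y)"
    unfolding set_lebesgue_integral_def
  proof (rule integral_mono)
    show "integrable lebesgue (\<lambda>y. \<Sum>j<J. m j * indicator (B j) y)"
      using fin by (intro Bochner_Integration.integrable_sum) auto
    show "integrable lebesgue (\<lambda>y. indicator (ball x 1 - \<Omega>) y *\<^sub>R kern x y)"
      using integrable_kern_near_outside[OF \<Omega>(1) x] by (simp add: set_integrable_def)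
    fix y
    show "(\<Sum>j<J. m j * indicator (B j) y) \<le> indicator (ball x 1 - \<Omega>) y *\<^sub>R kern x y"
    proof (cases "\<exists>j<J. y \<in> B j")
      case True
      then obtain j where j: "j < J" "y \<in> B j" by auto
      then have "(\<Sum>j<J. m j * indicator (B j) y) = m j"
        using disj by (intro sum_indicator_disjoint_family) auto
      then show ?thesis using low[OF j] sub[OF j] by simp
    next
      case False
      then have "(\<Sum>j<J. m j * indicator (B j) y) = 0"
        by (intro sum.neutral) auto
      then show ?thesis by (simp add: indicator_def)
    qed
  qed
  finally have 1: "(\<Sum>j<J. m j * measure lebesgue (B j)) \<le> (LINT y:ball x 1 - \<Omega>|lebesgue. kern x y)" .
  have "(LINT y:\<Omega> - ball x 1|lebesgue. kern x y) \<le> (LINT y|lebesgue. indicator \<Omega> y)"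
    unfolding set_lebesgue_integral_def
  proof (rule integral_mono)
    show "integrable lebesgue (\<lambda>y. indicator (\<Omega> - ball x 1) y *\<^sub>R kern x y)"
      using integrable_kern_far_inside[OF \<Omega>, of x] by (simp add: set_integrable_def)
    show "integrable lebesgue (indicator \<Omega> :: 'a \<Rightarrow> real)"
      using \<Omega> by (intro integrable_indicator_bounded) auto
    show "indicator (\<Omega> - ball x 1) y *\<^sub>R kern x y \<le> indicator \<Omega> y" for y
      using kern_le[of 1 x y] by (auto simp: dist_norm split: split_indicator)
  qed
  also have "(LINT y|lebesgue. indicator \<Omega> y) = measure lebesgue \<Omega>"
    using \<Omega> by simp
  finally have 2: "(LINT y:\<Omega> - ball x 1|lebesgue. kern x y) \<le> measure lebesgue \<Omega>" .
  have "h_fun p \<Omega> x = C_const DIM('a) p *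
      ((LINT y:ball x 1 - \<Omega>|lebesgue. kern x y) - (LINT y:\<Omega> - ball x 1|lebesgue. kern x y))"
    by (simp add: h_fun_def kern_def right_diff_distrib)
  then show ?thesis
    using 1 2 C_const_pos[OF p, where 'a='a] by simp
qed

text \<open>
  A point $z$ of the closure of $\Omega$ farthest from the origin has a whole half-space, and so
  a cone with vertex $z$, outside $\Omega$. The balls below lie in that cone.
\<close>

lemma exterior_balls:
  fixes \<Omega> :: "'a::euclidean_space set"
  assumes \<Omega>: "open \<Omega>" "bounded \<Omega>" "\<Omega> \<noteq> {}"
  obtains z e :: 'a where "z \<in> closure \<Omega>" "norm e = 1"
    "\<And>t y. y \<in> ball (z + t *\<^sub>R e) (t / 2) \<Longrightarrow> y \<notin> \<Omega>"
proof -
  have "compact (closure \<Omega>)" "closure \<Omega> \<noteq> {}" using \<Omega> by auto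
  then obtain z where z: "z \<in> closure \<Omega>" "\<And>y. y \<in> closure \<Omega> \<Longrightarrow> norm y \<le> norm z"
    using continuous_attains_sup[of "closure \<Omega>" norm] by (metis continuous_on_norm_id)
  have "z \<noteq> 0"
  proof
    assume "z = 0"
    then have "\<Omega> \<subseteq> {0}" using z(2) closure_subset by fastforce
    then have "\<Omega> = {0}" using \<Omega> by auto
    then show False using \<Omega>(1) not_open_singleton by metis
  qed
  define e where "e = (1 / norm z) *\<^sub>R z"
  have e: "norm e = 1" "z \<bullet> e = norm z" using \<open>z \<noteq> 0\<close>
    by (auto simp: e_def power2_norm_eq_inner[symmetric] power2_eq_square)
  have "y \<notin> \<Omega>" if y: "y \<in> ball (z + t *\<^sub>R e) (t / 2)" for t y
  proof
    assume "y \<in> \<Omega>"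
    then have "norm y \<le> norm z" using z(2) closure_subset by blast
    define \<xi> where "\<xi> = y - (z + t *\<^sub>R e)"
    have \<xi>: "norm \<xi> < t / 2" using y by (simp add: \<xi>_def dist_norm norm_minus_commute)
    then have t: "t > 0" using norm_ge_zero[of \<xi>] by linarith
    have "y = z + t *\<^sub>R e + \<xi>" by (simp add: \<xi>_def)
    then have "y \<bullet> e = norm z + t + \<xi> \<bullet> e"
      using e by (simp add: inner_add_left power2_norm_eq_inner[symmetric])
    moreover have "\<bar>\<xi> \<bullet> e\<bar> \<le> norm \<xi>" using Cauchy_Schwarz_ineq2[of \<xi> e] e by simp
    moreover have "y \<bullet> e \<le> norm y" using Cauchy_Schwarz_ineq2[of y e] e by simp
    ultimately show False using \<xi> t \<open>norm y \<le> norm z\<close> by linarith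
  qed
  with z e show ?thesis using that by blast
qed

text \<open>
  Close to the farthest point $z$ of the closure, $h_\Omega$ exceeds every bound: the kernel
  $|x-y|^{-N}$ is scale invariant, so each of the exterior balls of radius $4^{-j-1}/2$ at distance
  about $4^{-j-1}$ from $z$ contributes the same amount to the integral centred at $z$; as $x$ approaches $z$,
  this remains true, up to a constant, for more and more of them.
\<close>

lemma h_fun_unbounded:
  fixes \<Omega> :: "'a::euclidean_space set"
  assumes p: "1 < p" and \<Omega>: "open \<Omega>" "bounded \<Omega>" "\<Omega> \<noteq> {}"
  shows "\<not> (AE x in lebesgue. x \<in> \<Omega> \<longrightarrow> h_fun p \<Omega> x \<le> M)"
proof
  assume AE: "AE x in lebesgue. x \<in> \<Omega> \<longrightarrow> h_fun p \<Omega> x \<le> M"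
  obtain z e :: 'a where z: "z \<in> closure \<Omega>" and e: "norm e = 1"
    and out: "\<And>t y. y \<in> ball (z + t *\<^sub>R e) (t / 2) \<Longrightarrow> y \<notin> \<Omega>"
    using exterior_balls[OF \<Omega>] by metis
  \<comment> \<open>the ratio 4 makes the balls disjoint, since |y - z| lies between t/2 and 3t/2 on the ball with parameter t\<close>
  define t :: "nat \<Rightarrow> real" where "t j = (1 / 4) ^ Suc j" for j
  define B where "B j = ball (z + t j *\<^sub>R e) (t j / 2)" for j
  have t0: "0 < t j" for j by (simp add: t_def)
  have t4: "t i \<le> t j / 4" if "j < i" for i j
  proof -
    have "t i \<le> t (Suc j)" unfolding t_def using that by (intro power_decreasing) auto
    then show ?thesis by (simp add: t_def)
  qed
  have t_le: "t j \<le> 1 / 4" for j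
    using power_decreasing[of 1 "Suc j" "1/4::real"] by (simp add: t_def)
  have yB: "t j / 2 < norm (y - z)" "norm (y - z) < 3 / 2 * t j" if "y \<in> B j" for j y
  proof -
    have a: "norm (y - z - t j *\<^sub>R e) < t j / 2"
      using that by (simp add: B_def dist_norm norm_minus_commute algebra_simps)
    have b: "norm (t j *\<^sub>R e) = t j" using e t0[of j] by simp
    show "norm (y - z) < 3 / 2 * t j"
      using norm_triangle_ineq[of "y - z - t j *\<^sub>R e" "t j *\<^sub>R e"] a b by simp
    show "t j / 2 < norm (y - z)"
      using norm_triangle_ineq2[of "t j *\<^sub>R e" "y - z"] a b by (simp add: norm_minus_commute)
  qed
  define \<omega> where "\<omega> = measure lborel (ball (0::'a) 1)"
  have \<omega>: "0 < \<omega>" by (simp add: \<omega>_def content_ball_pos)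
  obtain J :: nat where J: "M / C_const DIM('a) p + measure lebesgue \<Omega> < real J * (\<omega> / 4 ^ DIM('a))"
    using ex_less_of_nat_mult[of "\<omega> / 4 ^ DIM('a)"] \<omega> by auto
  have "\<Omega> \<inter> ball z (t J) \<noteq> {}"
    using z t0[of J] by (metis closure_approachable disjoint_iff mem_ball dist_commute)
  then obtain x where x: "x \<in> \<Omega> \<inter> ball z (t J)" "x \<in> \<Omega> \<longrightarrow> h_fun p \<Omega> x \<le> M"
    using AE_nonempty_open[OF AE, of "\<Omega> \<inter> ball z (t J)"] \<Omega>(1) by (metis open_Int open_ball)
  have dx: "norm (x - y) < 2 * t j" "x \<noteq> y" if "j < J" "y \<in> B j" for j y
  proof -
    have "norm (x - y) \<le> norm (z - x) + norm (y - z)"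
      using norm_triangle_ineq[of "x - z" "z - y"] by (simp add: norm_minus_commute)
    then show "norm (x - y) < 2 * t j"
      using yB(2)[OF that(2)] x t4[OF that(1)] t0[of j] by (simp add: dist_norm)
    show "x \<noteq> y" using x that out by (auto simp: B_def)
  qed
  have "C_const DIM('a) p * ((\<Sum>j<J. (1 / (2 * t j) ^ DIM('a)) * measure lebesgue (B j)) - measure lebesgue \<Omega>)
      \<le> h_fun p \<Omega> x"
  proof (rule h_fun_lower_bound[OF p \<Omega>(1,2)])
    show "x \<in> \<Omega>" using x by simp
    show "B j \<in> sets borel" for j by (simp add: B_def)
    show "disjoint_family_on B {..<J}"
    proof -
      have "B i \<inter> B j = {}" if "i < j" for i j
        using yB(1)[of _ i] yB(2)[of _ j] t4[OF that] t0[of j] by fastforce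
      then show ?thesis unfolding disjoint_family_on_def by (metis Int_commute linorder_neqE_nat)
    qed
    fix j y assume j: "j < J" "y \<in> B j"
    show "y \<in> ball x 1 - \<Omega>"
      using dx[OF j] t_le[of j] out j by (auto simp: B_def dist_norm)
    show "1 / (2 * t j) ^ DIM('a) \<le> kern x y"
      unfolding kern_def using dx[OF j] t0[of j] by (intro divide_left_mono power_mono mult_pos_pos) auto
  qed
  moreover have "(1 / (2 * t j) ^ DIM('a)) * measure lebesgue (B j) = \<omega> / 4 ^ DIM('a)" for j
  proof -
    have "measure lebesgue (B j) = (t j / 2) ^ DIM('a) * \<omega>"
      unfolding B_def \<omega>_def using t0[of j] by (subst content_ball_conv_unit_ball[symmetric]) auto
    then have "(1 / (2 * t j) ^ DIM('a)) * measure lebesgue (B j) = ((t j / 2) / (2 * t j)) ^ DIM('a) * \<omega>"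
      unfolding power_divide[of "t j / 2" "2 * t j"] by simp
    also have "(t j / 2) / (2 * t j) = 1 / 4" using t0[of j] by (simp add: field_simps)
    finally show ?thesis by (simp add: power_divide)
  qed
  ultimately have "C_const DIM('a) p * (real J * (\<omega> / 4 ^ DIM('a)) - measure lebesgue \<Omega>) \<le> h_fun p \<Omega> x"
    by simp
  moreover have "M < C_const DIM('a) p * (real J * (\<omega> / 4 ^ DIM('a)) - measure lebesgue \<Omega>)"
    using J C_const_pos[OF p, where 'a='a] by (simp add: field_simps)
  ultimately show False using x by auto
qed

section \<open>The weak comparison principle\<close>

text \<open>
  The difference of two regional forms. Integrability allows the integrals to be merged, so that the
  signs of the two remaining integrands can be studied pointwise.
\<close>

lemma weak_ge_regional:
  fixes u v \<phi> c :: "'a::euclidean_space \<Rightarrow> real"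
  assumes p: "1 < p" and \<Omega>: "open \<Omega>" "bounded \<Omega>" and c: "c \<in> L_inf \<Omega>"
    and u: "u \<in> X0 p \<Omega>" and v: "v \<in> X0 p \<Omega>" and \<phi>: "\<phi> \<in> X0 p \<Omega>"
    and weak: "weak_ge p \<Omega> c u v" and pos: "AE x in lebesgue. 0 \<le> \<phi> x"
  defines "D \<equiv> (\<lambda>z. inside2 \<Omega> z * (pair_form p u \<phi> z - pair_form p v \<phi> z))"
    and "P \<equiv> (\<lambda>x. indicator \<Omega> x * ((rho DIM('a) p + h_fun p \<Omega> x - c x) * ((gpow p (u x) - gpow p (v x)) * \<phi> x)))"
  shows "integrable lebesgue2 D" and "integrable lebesgue P"
    and "0 \<le> C_const DIM('a) p / 2 * integral\<^sup>L lebesgue2 D + integral\<^sup>L lebesgue P"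
proof -
  have [measurable]: "\<Omega> \<in> sets lebesgue" using \<Omega> by auto
  have cu: "integrable lebesgue (\<lambda>x. indicator \<Omega> x * (c x * (gpow p (u x) * \<phi> x)))" (is "integrable _ ?f")
    if u: "u \<in> X0 p \<Omega>" for u
  proof -
    obtain M where M: "0 \<le> M" "AE x in lebesgue. x \<in> \<Omega> \<longrightarrow> \<bar>c x\<bar> \<le> M"
      using L_inf_bounded[OF c] by auto
    have i: "integrable lebesgue (\<lambda>x. gpow p (u x) * \<phi> x)" by (rule integrable_gpow_mult[OF p u \<phi>])
    note [measurable] = L_inf_measurable[OF c \<open>\<Omega> \<in> sets lebesgue\<close>] borel_measurable_integrable[OF i]
    have "(\<lambda>x. (indicator \<Omega> x * c x) * (gpow p (u x) * \<phi> x)) \<in> borel_measurable lebesgue"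
      by measurable
    then have m: "?f \<in> borel_measurable lebesgue" by (simp add: mult.assoc)
    show ?thesis
    proof (rule Bochner_Integration.integrable_bound[OF _ m])
      show "integrable lebesgue (\<lambda>x. M * (gpow p (u x) * \<phi> x))" using i by simp
      show "AE x in lebesgue. norm (?f x) \<le> norm (M * (gpow p (u x) * \<phi> x))"
        using M(2)
      proof eventually_elim
        case (elim x)
        have "\<bar>c x\<bar> * \<bar>gpow p (u x) * \<phi> x\<bar> \<le> M * \<bar>gpow p (u x) * \<phi> x\<bar>" if "x \<in> \<Omega>"
          using elim that by (intro mult_right_mono) auto
        then show ?case using M(1) by (auto simp: abs_mult split: split_indicator)
      qed
    qed
  qed
  have rh: "integrable lebesgue (\<lambda>x. indicator \<Omega> x * ((rho DIM('a) p + h_fun p \<Omega> x) * (gpow p (u x) * \<phi> x)))"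
    if u: "u \<in> X0 p \<Omega>" for u
  proof -
    have "integrable lebesgue (\<lambda>x. rho DIM('a) p * (indicator \<Omega> x * (gpow p (u x) * \<phi> x)))"
      using integrable_mult_indicator[OF _ integrable_gpow_mult[OF p u \<phi>], of \<Omega>] by simp
    from Bochner_Integration.integrable_add[OF this E_form_regional(1)[OF p u \<phi> \<Omega>]]
    show ?thesis by (simp only: algebra_simps)
  qed
  have pu: "integrable lebesgue2 (\<lambda>z. inside2 \<Omega> z * pair_form p u \<phi> z)" if "u \<in> X0 p \<Omega>" for u
    using that p \<phi> \<Omega> by (intro integrable_pair_form) auto
  have D: "D = (\<lambda>z. inside2 \<Omega> z * pair_form p u \<phi> z - inside2 \<Omega> z * pair_form p v \<phi> z)"
    by (simp add: D_def right_diff_distrib)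
  show "integrable lebesgue2 D"
    unfolding D using pu[OF u] pu[OF v] by simp
  define R where "R = (\<lambda>u x. indicator \<Omega> x * ((rho DIM('a) p + h_fun p \<Omega> x) * (gpow p (u x) * \<phi> x))
     - indicator \<Omega> x * (c x * (gpow p (u x) * \<phi> x)))"
  have R: "integrable lebesgue (R u)" if "u \<in> X0 p \<Omega>" for u
    unfolding R_def using rh[OF that] cu[OF that] by simp
  have P: "P = (\<lambda>x. R u x - R v x)"
    by (simp only: P_def R_def algebra_simps)
  show "integrable lebesgue P"
    unfolding P using R[OF u] R[OF v] by simp
  have E: "E_form p u \<phi> - (LINT x:\<Omega>|lebesgue. c x * gpow p (u x) * \<phi> x)
      = C_const DIM('a) p / 2 * (LINT z|lebesgue2. inside2 \<Omega> z * pair_form p u \<phi> z) + integral\<^sup>L lebesgue (R u)"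
    if "u \<in> X0 p \<Omega>" for u
    unfolding E_form_regional(2)[OF p that \<phi> \<Omega>] R_def set_lebesgue_integral_def
    using rh[OF that] cu[OF that] by (simp add: mult.assoc)
  have "E_form p v \<phi> - (LINT x:\<Omega>|lebesgue. c x * gpow p (v x) * \<phi> x)
      \<le> E_form p u \<phi> - (LINT x:\<Omega>|lebesgue. c x * gpow p (u x) * \<phi> x)"
    using weak pos \<phi> unfolding weak_ge_def by blast
  then show "0 \<le> C_const DIM('a) p / 2 * integral\<^sup>L lebesgue2 D + integral\<^sup>L lebesgue P"
    unfolding E[OF u] E[OF v] D P using pu[OF u] pu[OF v] R[OF u] R[OF v]
    by (simp add: algebra_simps)
qed

text \<open>
  Test with $w = (v-u)^+$. By monotonicity of $g$ and the bound on $c$, both integrands of the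
  regional inequality have the sign opposite to the one the inequality asserts, so both vanish almost
  everywhere. The double integral then forces $w$ to be constant on $\Omega$. If the constant were
  positive, the potential term would give $c = \rho_N(p) + h_\Omega$ almost everywhere in $\Omega$, which is
  impossible because $c$ is bounded and $h_\Omega$ is not.
\<close>

lemma weak_comparison:
  fixes u v c :: "'a::euclidean_space \<Rightarrow> real"
  assumes p: "1 < p" and \<Omega>: "open \<Omega>" "bounded \<Omega>" and c: "c \<in> L_inf \<Omega>"
    and c_le: "AE x in lebesgue. x \<in> \<Omega> \<longrightarrow> c x \<le> rho DIM('a) p + h_fun p \<Omega> x"
    and u: "u \<in> X0 p \<Omega>" and v: "v \<in> X0 p \<Omega>" and weak: "weak_ge p \<Omega> c u v"
  shows "AE x in lebesgue. v x \<le> u x"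
proof (rule ccontr)
  assume neg: "\<not> (AE x in lebesgue. v x \<le> u x)"
  define w where "w = (\<lambda>x. max 0 (v x - u x))"
  have [measurable]: "u \<in> borel_measurable lebesgue" "v \<in> borel_measurable lebesgue"
    using u v by (auto simp: X0_iff)
  have w: "w \<in> X0 p \<Omega>"
  proof (rule X0_dominated[OF u v])
    show "w \<in> borel_measurable lebesgue" unfolding w_def by measurable
    show "\<bar>w x\<bar> \<le> \<bar>u x\<bar> + \<bar>v x\<bar>" for x by (auto simp: w_def)
    show "\<bar>w x - w y\<bar> \<le> \<bar>u x - u y\<bar> + \<bar>v x - v y\<bar>" for x y by (auto simp: w_def max_def)
  qed (use p in simp)
  define D where "D = (\<lambda>z. inside2 \<Omega> z * (pair_form p u w z - pair_form p v w z))"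
  define P where "P = (\<lambda>x. indicator \<Omega> x * ((rho DIM('a) p + h_fun p \<Omega> x - c x) * ((gpow p (u x) - gpow p (v x)) * w x)))"
  have "AE x in lebesgue. 0 \<le> w x" by (simp add: w_def)
  note regional = weak_ge_regional[OF p \<Omega> c u v w weak this, folded D_def P_def]
  have D_eq: "- D (x, y) = inside2 \<Omega> (x, y) * ((gpow p (v x - v y) - gpow p (u x - u y)) * (w x - w y) * kern x y)" for x y
    by (simp add: D_def pair_form_def algebra_simps)
  have D_nonneg: "0 \<le> - D z" for z
  proof -
    obtain x y where z: "z = (x, y)" by force
    have "0 \<le> (gpow p (v x - v y) - gpow p (u x - u y)) * (w x - w y)"
      by (rule gpow_diff_mult_nonneg[OF p]) (auto simp: w_def)
    then have "0 \<le> (gpow p (v x - v y) - gpow p (u x - u y)) * (w x - w y) * kern x y"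
      by (rule mult_nonneg_nonneg) simp
    then show ?thesis unfolding z D_eq by (simp add: indicator_def)
  qed
  have P_nonneg: "AE x in lebesgue. 0 \<le> - P x"
    using c_le
  proof eventually_elim
    case (elim x)
    have le0: "(gpow p (u x) - gpow p (v x)) * w x \<le> 0"
      using gpow_mono[OF p, of "u x" "v x"] by (auto simp: w_def max_def intro: mult_nonpos_nonneg)
    have "(rho DIM('a) p + h_fun p \<Omega> x - c x) * ((gpow p (u x) - gpow p (v x)) * w x) \<le> 0" if "x \<in> \<Omega>"
      by (rule mult_nonneg_nonpos[OF _ le0]) (use elim that in simp)
    then show ?case by (auto simp: P_def split: split_indicator)
  qed
  have "0 \<le> integral\<^sup>L lebesgue2 (\<lambda>z. - D z)" by (rule Bochner_Integration.integral_nonneg) (rule D_nonneg)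
  moreover have "0 \<le> integral\<^sup>L lebesgue (\<lambda>x. - P x)" using P_nonneg by (intro integral_nonneg_AE)
  ultimately have D_le: "integral\<^sup>L lebesgue2 D \<le> 0" and P_le: "integral\<^sup>L lebesgue P \<le> 0"
    by simp_all
  have C: "0 < C_const DIM('a) p / 2" using C_const_pos[OF p, where 'a='a] by simp
  have "C_const DIM('a) p / 2 * integral\<^sup>L lebesgue2 D \<le> 0"
    by (rule mult_nonneg_nonpos[OF less_imp_le[OF C] D_le])
  then have "integral\<^sup>L lebesgue P = 0" "C_const DIM('a) p / 2 * integral\<^sup>L lebesgue2 D = 0"
    using regional(3) P_le by linarith+
  then have "integral\<^sup>L lebesgue (\<lambda>x. - P x) = 0" "integral\<^sup>L lebesgue2 (\<lambda>z. - D z) = 0"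
    using C by simp_all
  then have P0: "AE x in lebesgue. P x = 0" and D0: "AE z in lebesgue2. D z = 0"
    using integral_nonneg_eq_0_iff_AE[OF _ P_nonneg] integral_nonneg_eq_0_iff_AE[of lebesgue2 "\<lambda>z. - D z"]
      D_nonneg regional(1,2) by auto
  have w_eq: "w x = w y" if "D (x, y) = 0" "x \<in> \<Omega>" "y \<in> \<Omega>" for x y
  proof (rule ccontr)
    assume ne: "w x \<noteq> w y"
    then have "x \<noteq> y" by auto
    then have "kern x y \<noteq> 0" by (simp add: kern_def)
    moreover have "gpow p (v x - v y) \<noteq> gpow p (u x - u y)"
      using ne gpow_strict_mono[OF p, of "v x - v y" "u x - u y"] gpow_strict_mono[OF p, of "u x - u y" "v x - v y"]
      by (force simp: w_def)
    ultimately show False using D_eq[of x y] that ne by simp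
  qed
  have "AE x in lebesgue. AE y in lebesgue. D (x, y) = 0"
    using D0 by (rule lebesgue_pair.AE_pair)
  moreover have "AE x in lebesgue. x \<notin> \<Omega> \<longrightarrow> u x = 0" "AE x in lebesgue. x \<notin> \<Omega> \<longrightarrow> v x = 0"
    using u v by (auto simp: X0_iff)
  ultimately have "AE x in lebesgue. (AE y in lebesgue. D (x, y) = 0) \<and> (x \<notin> \<Omega> \<longrightarrow> v x \<le> u x)"
    by eventually_elim auto
  then obtain x where x: "AE y in lebesgue. D (x, y) = 0" "x \<in> \<Omega>" "u x < v x"
    using neg by (smt (verit, best) AE_mp eventually_mono)
  obtain M where M: "AE y in lebesgue. y \<in> \<Omega> \<longrightarrow> \<bar>c y\<bar> \<le> M"
    using L_inf_bounded[OF c] \<Omega> by auto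
  have "AE y in lebesgue. y \<in> \<Omega> \<longrightarrow> h_fun p \<Omega> y \<le> M - rho DIM('a) p"
    using x(1) P0 M
  proof eventually_elim
    case (elim y)
    show ?case
    proof
      assume y: "y \<in> \<Omega>"
      have "w y = w x" using w_eq[OF elim(1) x(2) y] by simp
      then have "u y < v y" "w y \<noteq> 0" using x(3) by (auto simp: w_def max_def split: if_splits)
      then have "rho DIM('a) p + h_fun p \<Omega> y - c y = 0"
        using elim(2) y gpow_strict_mono[OF p, of "u y" "v y"] by (simp add: P_def)
      then show "h_fun p \<Omega> y \<le> M - rho DIM('a) p" using elim(3) y by auto
    qed
  qed
  with h_fun_unbounded[OF p \<Omega>] x(2) show False by blast
qed

section \<open>Riesz kernels and Lipschitz functions in the energy space\<close>

text \<open>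
  The truncated Riesz kernel $|x-y|^{q-N}$: the Hoelder gain $|x-y|^q$ makes the critical kernel
  integrable.
\<close>

definition riesz_kern :: "real \<Rightarrow> real \<Rightarrow> 'a::euclidean_space \<times> 'a \<Rightarrow> real" where
  "riesz_kern q R z = indicator {z. norm (fst z - snd z) < R} z *
     (norm (fst z - snd z) powr q * kern (fst z) (snd z))"

lemma riesz_kern_nonneg [simp]: "0 \<le> riesz_kern q R z"
  by (simp add: riesz_kern_def)

lemma riesz_kern_swap: "riesz_kern q R (y, x) = riesz_kern q R (x, y)"
  by (simp add: riesz_kern_def norm_minus_commute kern_commute[of y x] indicator_def)

lemma borel_measurable_riesz_kern [measurable]: "riesz_kern q R \<in> borel_measurable lebesgue2"
  unfolding riesz_kern_def by measurable

text \<open>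
  Dyadic decomposition of the kernel into the shells $R\,2^{-k-1} \le |x-y| < R\,2^{-k}$.
\<close>

lemma riesz_kern_le_dyadic:
  fixes x y :: "'a::euclidean_space"
  assumes "0 < q" "0 < R"
  shows "ennreal (riesz_kern q R (x, y)) \<le>
     (\<Sum>k. ennreal ((R / 2 ^ k) powr q * (2 / (R / 2 ^ k)) ^ DIM('a)) * indicator (ball x (R / 2 ^ k)) y)"
    (is "_ \<le> (\<Sum>k. ?a k)")
proof (cases "x \<noteq> y \<and> norm (x - y) < R")
  case False
  then show ?thesis using assms by (auto simp: riesz_kern_def)
next
  case True
  define d where "d = norm (x - y)"
  have d: "0 < d" "d < R" using True by (auto simp: d_def)
  obtain n0 where "(1 / 2) ^ n0 < d / R"
    using real_arch_pow_inv[of "d / R" "1 / 2"] d by auto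
  then have n0: "R / 2 ^ n0 \<le> d" using assms by (simp add: field_simps power_one_over)
  define n where "n = (LEAST n. R / 2 ^ n \<le> d)"
  have n: "R / 2 ^ n \<le> d" unfolding n_def by (rule LeastI[of _ n0]) (rule n0)
  then have "n \<noteq> 0" using d by (cases n) auto
  then obtain k where k: "n = Suc k" by (cases n) auto
  have dk: "d < R / 2 ^ k"
    using not_less_Least[of k "\<lambda>n. R / 2 ^ n \<le> d"] k by (simp add: n_def[symmetric])
  have kd: "(R / 2 ^ k) / 2 \<le> d" using n k by (simp add: field_simps)
  have "riesz_kern q R (x, y) = d powr q * kern x y"
    using d by (simp add: riesz_kern_def d_def)
  also have "\<dots> \<le> (R / 2 ^ k) powr q * (1 / ((R / 2 ^ k) / 2) ^ DIM('a))"
    using dk kd assms d by (intro mult_mono powr_mono2 kern_le) (auto simp: d_def)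
  also have "1 / ((R / 2 ^ k) / 2) ^ DIM('a) = (2 / (R / 2 ^ k)) ^ DIM('a)"
    by (simp add: power_divide)
  finally have "ennreal (riesz_kern q R (x, y)) \<le> ?a k"
    using dk by (simp add: d_def dist_norm ennreal_leI)
  also have "?a k = sum ?a {k}" by (simp only: sum.insert finite.emptyI empty_iff not_False_eq_True sum.empty add_0_right)
  also have "\<dots> \<le> (\<Sum>k. ?a k)" by (rule sum_le_suminf) auto
  finally show ?thesis .
qed

text \<open>
  The shell of index $k$ contributes a constant times $2^{-qk}$, whence a geometric series.
\<close>

lemma nn_integral_riesz_kern:
  assumes "0 < q" "0 < R"
  obtains J where "0 \<le> J"
    "\<And>x::'a::euclidean_space. (\<integral>\<^sup>+ y. ennreal (riesz_kern q R (x, y)) \<partial>lebesgue) \<le> ennreal J"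
proof -
  define \<omega> where "\<omega> = measure lborel (ball (0::'a) 1)"
  have \<omega>: "0 < \<omega>" by (simp add: \<omega>_def content_ball_pos)
  define b where "b k = (\<omega> * 2 ^ DIM('a) * R powr q) * (2 powr (- q)) ^ k" for k :: nat
  have b0: "0 \<le> b k" for k using \<omega> by (simp add: b_def)
  have "2 powr (- q) < (1::real)"
    using powr_less_mono[of "- q" 0 2] assms by simp
  then have sb: "summable b" unfolding b_def by (intro summable_mult summable_geometric) auto
  show ?thesis
  proof
    show "0 \<le> suminf b" using sb b0 by (rule suminf_nonneg)
    fix x :: 'a
    define s where "s k = R / 2 ^ k" for k :: nat
    have s0: "0 < s k" for k using assms by (simp add: s_def)
    have "(\<integral>\<^sup>+ y. ennreal (riesz_kern q R (x, y)) \<partial>lebesgue) \<le>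
        (\<integral>\<^sup>+ y. (\<Sum>k. ennreal (s k powr q * (2 / s k) ^ DIM('a)) * indicator (ball x (s k)) y) \<partial>lebesgue)"
      unfolding s_def by (intro nn_integral_mono riesz_kern_le_dyadic assms)
    also have "\<dots> = (\<Sum>k. (\<integral>\<^sup>+ y. ennreal (s k powr q * (2 / s k) ^ DIM('a)) * indicator (ball x (s k)) y \<partial>lebesgue))"
    proof (rule nn_integral_suminf)
      fix k
      have [measurable]: "ball x (s k) \<in> sets lebesgue" by auto
      show "(\<lambda>y. ennreal (s k powr q * (2 / s k) ^ DIM('a)) * indicator (ball x (s k)) y) \<in> borel_measurable lebesgue"
        by measurable
    qed
    also have "\<dots> = (\<Sum>k. ennreal (b k))"
    proof (intro suminf_cong)
      fix k
      have sk: "s k powr q = R powr q * (2 powr (- q)) ^ k"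
      proof -
        have "((2::real) ^ k) powr q = (2 powr real k) powr q" by (simp only: powr_realpow[of 2 k] zero_less_numeral)
        also have "\<dots> = (2 powr q) powr real k" by (simp only: powr_powr mult.commute)
        also have "\<dots> = (2 powr q) ^ k" by (rule powr_realpow) simp
        finally have "((2::real) ^ k) powr q = (2 powr q) ^ k" .
        moreover have "s k powr q = R powr q / (2 ^ k) powr q"
          unfolding s_def by (rule powr_divide)
        moreover have "(2::real) powr (- q) = 1 / 2 powr q" by (rule powr_minus_divide)
        ultimately show ?thesis by (simp add: power_divide)
      qed
      have "(\<integral>\<^sup>+ y. ennreal (s k powr q * (2 / s k) ^ DIM('a)) * indicator (ball x (s k)) y \<partial>lebesgue)
         = ennreal (s k powr q * (2 / s k) ^ DIM('a)) * emeasure lebesgue (ball x (s k))"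
        by (intro nn_integral_cmult_indicator) auto
      also have "emeasure lebesgue (ball x (s k)) = ennreal (s k ^ DIM('a) * \<omega>)"
      proof -
        have "emeasure lebesgue (ball x (s k)) = emeasure lborel (ball x (s k))" by simp
        also have "\<dots> = ennreal (measure lborel (ball x (s k)))"
          using emeasure_lborel_ball_finite[of x "s k"] by (intro emeasure_eq_ennreal_measure) auto
        also have "measure lborel (ball x (s k)) = s k ^ DIM('a) * \<omega>"
          unfolding \<omega>_def using s0[of k] by (intro content_ball_conv_unit_ball) auto
        finally show ?thesis .
      qed
      also have "ennreal (s k powr q * (2 / s k) ^ DIM('a)) * ennreal (s k ^ DIM('a) * \<omega>)
         = ennreal (s k powr q * (2 / s k) ^ DIM('a) * (s k ^ DIM('a) * \<omega>))"
        using \<omega> s0[of k] by (intro ennreal_mult[symmetric]) auto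
      also have "s k powr q * (2 / s k) ^ DIM('a) * (s k ^ DIM('a) * \<omega>) = \<omega> * 2 ^ DIM('a) * s k powr q"
        using s0[of k] by (simp add: power_divide)
      also have "\<omega> * 2 ^ DIM('a) * s k powr q = b k" by (simp add: sk b_def)
      finally show "(\<integral>\<^sup>+ y. ennreal (s k powr q * (2 / s k) ^ DIM('a)) * indicator (ball x (s k)) y \<partial>lebesgue) = ennreal (b k)" .
    qed
    also have "\<dots> = ennreal (suminf b)"
      by (rule suminf_ennreal2[OF b0 sb])
    finally show "(\<integral>\<^sup>+ y. ennreal (riesz_kern q R (x, y)) \<partial>lebesgue) \<le> ennreal (suminf b)" .
  qed
qed

lemma integrable_riesz_kern_weight:
  fixes \<psi> :: "'a::euclidean_space \<Rightarrow> real"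
  assumes J: "0 \<le> J" "\<And>x::'a. (\<integral>\<^sup>+ y. ennreal (riesz_kern q R (x, y)) \<partial>lebesgue) \<le> ennreal J"
    and \<psi>: "integrable lebesgue \<psi>" "\<And>x. 0 \<le> \<psi> x"
  shows "integrable lebesgue2 (\<lambda>z. \<psi> (fst z) * riesz_kern q R z)"
    and "(LINT z|lebesgue2. \<psi> (fst z) * riesz_kern q R z) \<le> J * integral\<^sup>L lebesgue \<psi>"
proof -
  have [measurable]: "\<psi> \<in> borel_measurable lebesgue" using \<psi> by auto
  have "(\<integral>\<^sup>+ z. ennreal (\<psi> (fst z) * riesz_kern q R z) \<partial>lebesgue2)
      = (\<integral>\<^sup>+ x. (\<integral>\<^sup>+ y. ennreal (\<psi> x * riesz_kern q R (x, y)) \<partial>lebesgue) \<partial>lebesgue)"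
    by (subst lebesgue.nn_integral_fst[symmetric]) auto
  also have "\<dots> = (\<integral>\<^sup>+ x. ennreal (\<psi> x) * (\<integral>\<^sup>+ y. ennreal (riesz_kern q R (x, y)) \<partial>lebesgue) \<partial>lebesgue)"
  proof (intro nn_integral_cong)
    fix x :: 'a
    have [measurable]: "(\<lambda>y. riesz_kern q R (x, y)) \<in> borel_measurable lebesgue"
      by (rule measurable_Pair2[OF borel_measurable_riesz_kern]) simp
    show "(\<integral>\<^sup>+ y. ennreal (\<psi> x * riesz_kern q R (x, y)) \<partial>lebesgue) = ennreal (\<psi> x) * (\<integral>\<^sup>+ y. ennreal (riesz_kern q R (x, y)) \<partial>lebesgue)"
      using \<psi>(2) by (simp add: ennreal_mult nn_integral_cmult)
  qed
  also have "\<dots> \<le> (\<integral>\<^sup>+ x. ennreal J * ennreal (\<psi> x) \<partial>lebesgue)"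
  proof (rule nn_integral_mono)
    show "ennreal (\<psi> x) * (\<integral>\<^sup>+ y. ennreal (riesz_kern q R (x, y)) \<partial>lebesgue) \<le> ennreal J * ennreal (\<psi> x)" for x
      unfolding mult.commute[of "ennreal J"] by (rule mult_left_mono[OF J(2)]) simp
  qed
  also have "\<dots> = ennreal J * ennreal (integral\<^sup>L lebesgue \<psi>)"
    using \<psi> by (simp add: nn_integral_cmult nn_integral_eq_integral)
  also have "\<dots> = ennreal (J * integral\<^sup>L lebesgue \<psi>)"
    using J \<psi> by (intro ennreal_mult[symmetric]) auto
  finally have nn: "(\<integral>\<^sup>+ z. ennreal (\<psi> (fst z) * riesz_kern q R z) \<partial>lebesgue2) \<le> ennreal (J * integral\<^sup>L lebesgue \<psi>)" .
  show int: "integrable lebesgue2 (\<lambda>z. \<psi> (fst z) * riesz_kern q R z)"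
  proof (rule integrableI_bounded)
    show "(\<lambda>z. \<psi> (fst z) * riesz_kern q R z) \<in> borel_measurable lebesgue2" by measurable
    have "(\<integral>\<^sup>+ z. ennreal (norm (\<psi> (fst z) * riesz_kern q R z)) \<partial>lebesgue2)
        = (\<integral>\<^sup>+ z. ennreal (\<psi> (fst z) * riesz_kern q R z) \<partial>lebesgue2)"
      using \<psi>(2) by (simp add: abs_mult)
    also have "\<dots> < \<infinity>"
      using nn by (rule le_less_trans) simp
    finally show "(\<integral>\<^sup>+ z. ennreal (norm (\<psi> (fst z) * riesz_kern q R z)) \<partial>lebesgue2) < \<infinity>" .
  qed
  have "(LINT z|lebesgue2. \<psi> (fst z) * riesz_kern q R z) = enn2real (\<integral>\<^sup>+ z. ennreal (\<psi> (fst z) * riesz_kern q R z) \<partial>lebesgue2)"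
    using int \<psi>(2) by (intro integral_eq_nn_integral) auto
  also have "\<dots> \<le> J * integral\<^sup>L lebesgue \<psi>"
    using nn J \<psi> by (intro enn2real_leI) auto
  finally show "(LINT z|lebesgue2. \<psi> (fst z) * riesz_kern q R z) \<le> J * integral\<^sup>L lebesgue \<psi>" .
qed

text \<open>
  The energy density is at most a multiple of the Riesz kernel with exponent $p$, and it vanishes
  unless one of the two points lies in $\Omega$.
\<close>

lemma Lipschitz_in_X0:
  fixes f :: "'a::euclidean_space \<Rightarrow> real"
  assumes p: "0 < p" and \<Omega> [measurable]: "\<Omega> \<in> sets lebesgue" and b: "bounded \<Omega>"
    and f [measurable]: "f \<in> borel_measurable lebesgue" and zero: "\<And>x. x \<notin> \<Omega> \<Longrightarrow> f x = 0"
    and bd: "\<And>x. \<bar>f x\<bar> \<le> B" and lip: "\<And>x y. \<bar>f x - f y\<bar> \<le> L * norm (x - y)"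
  shows "f \<in> X0 p \<Omega>"
proof -
  have iO: "integrable lebesgue (indicator \<Omega> :: 'a \<Rightarrow> real)"
    by (rule integrable_indicator_bounded[OF \<Omega> b])
  have "integrable lebesgue (\<lambda>x. \<bar>f x\<bar> powr p)"
  proof (rule Bochner_Integration.integrable_bound)
    show "integrable lebesgue (\<lambda>x. B powr p * indicator \<Omega> x)" using iO by simp
    show "AE x in lebesgue. norm (\<bar>f x\<bar> powr p) \<le> norm (B powr p * indicator \<Omega> x)"
    proof (intro AE_I2)
      show "norm (\<bar>f x\<bar> powr p) \<le> norm (B powr p * indicator \<Omega> x)" for x
        using bd[of x] zero[of x] p by (cases "x \<in> \<Omega>") (auto intro: powr_mono2)
    qed
  qed measurable
  moreover have "integrable lebesgue2 (near_energy p f)"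
  proof (rule Bochner_Integration.integrable_bound)
    obtain J where J: "0 \<le> J" "\<And>x::'a. (\<integral>\<^sup>+ y. ennreal (riesz_kern p 1 (x, y)) \<partial>lebesgue) \<le> ennreal J"
      using nn_integral_riesz_kern[OF p zero_less_one] by blast
    have "integrable lebesgue2 (\<lambda>z. indicator \<Omega> (fst z) * riesz_kern p 1 z)"
      using J iO indicator_pos_le by (rule integrable_riesz_kern_weight(1))
    note i = this pair_swap_lebesgue(1)[OF this]
    show "integrable lebesgue2 (\<lambda>z. \<bar>L\<bar> powr p * (indicator \<Omega> (fst z) * riesz_kern p 1 z + indicator \<Omega> (snd z) * riesz_kern p 1 (snd z, fst z)))"
      using i by simp
    show "AE z in lebesgue2. norm (near_energy p f z)
       \<le> norm (\<bar>L\<bar> powr p * (indicator \<Omega> (fst z) * riesz_kern p 1 z + indicator \<Omega> (snd z) * riesz_kern p 1 (snd z, fst z)))"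
    proof (intro AE_I2)
      fix z :: "'a \<times> 'a"
      obtain x y where z: "z = (x, y)" by force
      have "\<bar>f x - f y\<bar> \<le> \<bar>L\<bar> * norm (x - y)"
        using lip[of x y] mult_right_mono[OF abs_ge_self[of L], of "norm (x - y)"] by simp
      then have "\<bar>f x - f y\<bar> powr p \<le> (\<bar>L\<bar> * norm (x - y)) powr p"
        using p by (intro powr_mono2) auto
      also have "\<dots> = \<bar>L\<bar> powr p * norm (x - y) powr p" by (simp add: powr_mult)
      finally have "\<bar>f x - f y\<bar> powr p * kern x y \<le> \<bar>L\<bar> powr p * norm (x - y) powr p * kern x y"
        by (rule mult_right_mono) simp
      then have le: "near_energy p f z \<le> \<bar>L\<bar> powr p * riesz_kern p 1 z"
        by (auto simp: z near_def riesz_kern_def mult_ac split: split_indicator)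
      have nn: "0 \<le> near_energy p f z" using near_cases[of z] by auto
      have sw: "riesz_kern p 1 (y, x) = riesz_kern p 1 (x, y)" by (rule riesz_kern_swap)
      show "norm (near_energy p f z)
       \<le> norm (\<bar>L\<bar> powr p * (indicator \<Omega> (fst z) * riesz_kern p 1 z + indicator \<Omega> (snd z) * riesz_kern p 1 (snd z, fst z)))"
      proof (cases "x \<in> \<Omega> \<or> y \<in> \<Omega>")
        case True
        have "norm (near_energy p f z) \<le> \<bar>L\<bar> powr p * riesz_kern p 1 z" using le nn by simp
        also have "\<dots> \<le> \<bar>L\<bar> powr p * (indicator \<Omega> (fst z) * riesz_kern p 1 z + indicator \<Omega> (snd z) * riesz_kern p 1 (snd z, fst z))"
          using True by (intro mult_left_mono) (auto simp: z sw split: split_indicator)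
        also have "\<dots> \<le> norm \<dots>" unfolding real_norm_def by (rule abs_ge_self)
        finally show ?thesis .
      next
        case False
        then show ?thesis using zero p by (simp add: z)
      qed
    qed
  qed measurable
  ultimately show ?thesis using zero by (simp add: X0_iff)
qed

section \<open>Cutoff functions and the pointwise estimate\<close>

text \<open>
  In the interior, at distance at least $r$ from the complement of $\Omega$, the kernel is at most
  $r^{-N}$ on the set that contributes positively to $h_\Omega$.
\<close>

lemma h_fun_upper_bound:
  fixes \<Omega> :: "'a::euclidean_space set"
  assumes p: "1 < p" and \<Omega>: "open \<Omega>" and r: "0 < r" and x: "ball x r \<subseteq> \<Omega>"
  shows "h_fun p \<Omega> x \<le> C_const DIM('a) p * (1 / r ^ DIM('a) * measure lborel (ball (0::'a) 1))"
proof -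
  have "x \<in> \<Omega>" using x r by auto
  have ib: "integrable lebesgue (\<lambda>y. 1 / r ^ DIM('a) * indicator (ball x 1) y :: real)"
    by (intro integrable_mult_right integrable_indicator_bounded) auto
  have "(LINT y:ball x 1 - \<Omega>|lebesgue. kern x y) \<le> (LINT y|lebesgue. 1 / r ^ DIM('a) * indicator (ball x 1) y)"
    unfolding set_lebesgue_integral_def
  proof (rule integral_mono[OF _ ib])
    show "integrable lebesgue (\<lambda>y. indicator (ball x 1 - \<Omega>) y *\<^sub>R kern x y)"
      using integrable_kern_near_outside[OF \<Omega> \<open>x \<in> \<Omega>\<close>] by (simp add: set_integrable_def)
    fix y
    have "kern x y \<le> 1 / r ^ DIM('a)" if "y \<notin> \<Omega>"
      using that x r by (intro kern_le) (auto simp: dist_norm not_less[symmetric] subset_iff)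
    then show "indicator (ball x 1 - \<Omega>) y *\<^sub>R kern x y \<le> 1 / r ^ DIM('a) * indicator (ball x 1) y"
      using r by (auto split: split_indicator)
  qed
  also have "\<dots> = 1 / r ^ DIM('a) * measure lebesgue (ball x 1)"
    by simp
  also have "measure lebesgue (ball x 1) = measure lborel (ball (0::'a) 1)"
    using content_ball_conv_unit_ball[of 1 x] by simp
  finally have 1: "(LINT y:ball x 1 - \<Omega>|lebesgue. kern x y) \<le> 1 / r ^ DIM('a) * measure lborel (ball (0::'a) 1)" .
  have 2: "0 \<le> (LINT y:\<Omega> - ball x 1|lebesgue. kern x y)"
    unfolding set_lebesgue_integral_def by (rule Bochner_Integration.integral_nonneg) simp
  have "h_fun p \<Omega> x = C_const DIM('a) p *
      ((LINT y:ball x 1 - \<Omega>|lebesgue. kern x y) - (LINT y:\<Omega> - ball x 1|lebesgue. kern x y))"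
    by (simp add: h_fun_def kern_def right_diff_distrib)
  also have "\<dots> \<le> C_const DIM('a) p * (1 / r ^ DIM('a) * measure lborel (ball (0::'a) 1))"
    using 1 2 C_const_pos[OF p, where 'a='a] by (intro mult_left_mono) linarith+
  finally show ?thesis .
qed

text \<open>
  The radius $r$ is half the distance that keeps $K$ inside $\Omega$, so that around every point where
  $f$ does not vanish there is still a ball of radius $r$ in $\Omega$; this bounds $h_\Omega$ there.
\<close>

lemma Lipschitz_cutoff:
  fixes K \<Omega> :: "'a::euclidean_space set"
  assumes "compact K" "open \<Omega>" "K \<subseteq> \<Omega>" "K \<noteq> {}"
  obtains f :: "'a \<Rightarrow> real" and r where "0 < r" "continuous_on UNIV f"
    "\<And>x. 0 \<le> f x" "\<And>x. f x \<le> 1" "\<And>x. x \<in> K \<Longrightarrow> f x = 1"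
    "\<And>x. f x \<noteq> 0 \<Longrightarrow> ball x r \<subseteq> \<Omega>" "\<And>x y. \<bar>f x - f y\<bar> \<le> 1 / r * norm (x - y)"
proof -
  obtain e where e: "e > 0" "(\<Union>x\<in>K. ball x e) \<subseteq> \<Omega>"
    using compact_subset_open_imp_ball_epsilon_subset[OF assms(1-3)] by blast
  define r where "r = e / 2"
  have r: "0 < r" using e by (simp add: r_def)
  define f where "f x = max 0 (1 - infdist x K / r)" for x
  show ?thesis
  proof
    show "0 < r" by (rule r)
    show "continuous_on UNIV f" unfolding f_def by (intro continuous_intros) (use r in auto)
    show "0 \<le> f x" "f x \<le> 1" for x using r by (auto simp: f_def infdist_nonneg)
    show "f x = 1" if "x \<in> K" for x using that by (simp add: f_def)
    show "ball x r \<subseteq> \<Omega>" if "f x \<noteq> 0" for x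
    proof -
      have "infdist x K < r" using that r by (auto simp: f_def max_def field_simps split: if_splits)
      moreover obtain a where a: "a \<in> K" "infdist x K = dist x a"
        using infdist_attains_inf[of K x] assms compact_imp_closed by metis
      ultimately have "dist a y < e" if "dist x y < r" for y
        using dist_triangle[of a y x] that by (simp add: r_def dist_commute)
      then have "ball x r \<subseteq> ball a e" by auto
      then show ?thesis using e a by blast
    qed
    show "\<bar>f x - f y\<bar> \<le> 1 / r * norm (x - y)" for x y
    proof -
      have "\<bar>f x - f y\<bar> \<le> \<bar>infdist x K / r - infdist y K / r\<bar>"
        by (auto simp: f_def)
      also have "\<dots> = 1 / r * \<bar>infdist x K - infdist y K\<bar>"
        using r by (simp add: diff_divide_distrib[symmetric] abs_divide)
      also have "\<dots> \<le> 1 / r * norm (x - y)"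
        using infdist_triangle_abs[of x K y] r by (intro mult_left_mono) (auto simp: dist_norm)
      finally show ?thesis .
    qed
  qed
qed

text \<open>
  The pointwise inequality behind the strong comparison principle. Put $w = v + \varepsilon f$, so
  that $\varphi = (w-u)^+$, and split
  $g(u_1-u_2) - g(v_1-v_2) = [g(u_1-u_2) - g(w_1-w_2)] + [g(w_1-w_2) - g(v_1-v_2)]$.
  The first bracket times $\varphi_1 - \varphi_2$ is nonpositive by monotonicity. If moreover $u - v \ge \delta$
  at the second point, then $\varphi_2 = 0$, and where $\varphi_1 > 0$ the arguments of the first bracket differ
  by at least $\delta/2$; this produces the gain $\eta \varphi_1$. The second bracket is small by Hoelder
  continuity, since the arguments differ by $\varepsilon (f_1 - f_2)$.
\<close>

lemma pair_difference_estimate: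
  fixes p M H L t \<epsilon> \<delta> \<eta> q u\<^sub>1 u\<^sub>2 v\<^sub>1 v\<^sub>2 f\<^sub>1 f\<^sub>2 :: real
  assumes p: "1 < p" and q: "0 \<le> q" and f: "0 \<le> f\<^sub>1" "f\<^sub>1 \<le> 1" "0 \<le> f\<^sub>2" "f\<^sub>2 \<le> 1"
    and v: "\<bar>v\<^sub>1\<bar> \<le> M" "\<bar>v\<^sub>2\<bar> \<le> M" and \<epsilon>: "0 < \<epsilon>" "\<epsilon> \<le> 1" "\<epsilon> \<le> \<delta> / 2" and H: "0 \<le> H"
    and gap: "\<And>a b. \<bar>a\<bar> \<le> 2 * M + 2 \<Longrightarrow> b \<le> a - \<delta> / 2 \<Longrightarrow> \<eta> \<le> gpow p a - gpow p b"
    and hoelder: "\<And>a b. \<bar>a\<bar> \<le> 2 * M + 2 \<Longrightarrow> \<bar>b\<bar> \<le> 2 * M + 2 \<Longrightarrow>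
        \<bar>gpow p a - gpow p b\<bar> \<le> H * \<bar>a - b\<bar> powr q"
    and lip: "\<bar>f\<^sub>1 - f\<^sub>2\<bar> \<le> L * t"
  defines "\<phi>\<^sub>1 \<equiv> max 0 (\<epsilon> * f\<^sub>1 - (u\<^sub>1 - v\<^sub>1))" and "\<phi>\<^sub>2 \<equiv> max 0 (\<epsilon> * f\<^sub>2 - (u\<^sub>2 - v\<^sub>2))"
  shows "(gpow p (u\<^sub>1 - u\<^sub>2) - gpow p (v\<^sub>1 - v\<^sub>2)) * (\<phi>\<^sub>1 - \<phi>\<^sub>2)
     \<le> H * (\<epsilon> * (L * t)) powr q * (\<phi>\<^sub>1 + \<phi>\<^sub>2) - (if \<delta> \<le> u\<^sub>2 - v\<^sub>2 then \<eta> * \<phi>\<^sub>1 else 0)"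
proof -
  define w\<^sub>1 w\<^sub>2 where "w\<^sub>1 = v\<^sub>1 + \<epsilon> * f\<^sub>1" and "w\<^sub>2 = v\<^sub>2 + \<epsilon> * f\<^sub>2"
  have ef: "0 \<le> \<epsilon> * f\<^sub>1" "\<epsilon> * f\<^sub>1 \<le> \<epsilon>" "0 \<le> \<epsilon> * f\<^sub>2" "\<epsilon> * f\<^sub>2 \<le> \<epsilon>"
    using \<epsilon> f by (auto simp: mult_left_le)
  have vb: "\<bar>v\<^sub>1 - v\<^sub>2\<bar> \<le> 2 * M + 2" and wb: "\<bar>w\<^sub>1 - w\<^sub>2\<bar> \<le> 2 * M + 2"
    using v ef \<epsilon>(2) unfolding w\<^sub>1_def w\<^sub>2_def by linarith+
  have \<phi>: "\<phi>\<^sub>1 = max 0 (w\<^sub>1 - u\<^sub>1)" "\<phi>\<^sub>2 = max 0 (w\<^sub>2 - u\<^sub>2)"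
    by (simp_all add: \<phi>\<^sub>1_def \<phi>\<^sub>2_def w\<^sub>1_def w\<^sub>2_def algebra_simps)
  have \<phi>0: "0 \<le> \<phi>\<^sub>1" "0 \<le> \<phi>\<^sub>2" by (simp_all add: \<phi>)
  have S: "(if \<delta> \<le> u\<^sub>2 - v\<^sub>2 then \<eta> * \<phi>\<^sub>1 else 0)
      \<le> (gpow p (w\<^sub>1 - w\<^sub>2) - gpow p (u\<^sub>1 - u\<^sub>2)) * (\<phi>\<^sub>1 - \<phi>\<^sub>2)"
  proof (cases "\<delta> \<le> u\<^sub>2 - v\<^sub>2 \<and> 0 < \<phi>\<^sub>1")
    case True
    have "\<epsilon> * f\<^sub>2 - (u\<^sub>2 - v\<^sub>2) \<le> 0" using True[THEN conjunct1] ef(4) \<epsilon>(1,3) by linarith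
    then have "\<phi>\<^sub>2 = 0" by (simp add: \<phi>\<^sub>2_def)
    have "u\<^sub>1 - u\<^sub>2 \<le> (w\<^sub>1 - w\<^sub>2) - \<delta> / 2"
    proof -
      have "0 < w\<^sub>1 - u\<^sub>1" using True[THEN conjunct2] unfolding \<phi> by (simp add: less_max_iff_disj)
      then show ?thesis using True[THEN conjunct1] ef(4) \<epsilon>(3) unfolding w\<^sub>2_def by linarith
    qed
    then have "\<eta> \<le> gpow p (w\<^sub>1 - w\<^sub>2) - gpow p (u\<^sub>1 - u\<^sub>2)" by (rule gap[OF wb])
    then have "\<eta> * \<phi>\<^sub>1 \<le> (gpow p (w\<^sub>1 - w\<^sub>2) - gpow p (u\<^sub>1 - u\<^sub>2)) * \<phi>\<^sub>1"
      using \<phi>0 by (intro mult_right_mono)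
    then show ?thesis using True \<open>\<phi>\<^sub>2 = 0\<close> by simp
  next
    case False
    have "0 \<le> (gpow p (w\<^sub>1 - w\<^sub>2) - gpow p (u\<^sub>1 - u\<^sub>2)) * (\<phi>\<^sub>1 - \<phi>\<^sub>2)"
      by (rule gpow_diff_mult_nonneg[OF p]) (auto simp: \<phi>)
    moreover have "(if \<delta> \<le> u\<^sub>2 - v\<^sub>2 then \<eta> * \<phi>\<^sub>1 else 0) = 0" using False \<phi>0 by auto
    ultimately show ?thesis by simp
  qed
  have "\<bar>gpow p (w\<^sub>1 - w\<^sub>2) - gpow p (v\<^sub>1 - v\<^sub>2)\<bar> \<le> H * \<bar>(w\<^sub>1 - w\<^sub>2) - (v\<^sub>1 - v\<^sub>2)\<bar> powr q"
    by (rule hoelder[OF wb vb])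
  also have "\<dots> \<le> H * (\<epsilon> * (L * t)) powr q"
  proof (intro mult_left_mono powr_mono2)
    have "(w\<^sub>1 - w\<^sub>2) - (v\<^sub>1 - v\<^sub>2) = \<epsilon> * (f\<^sub>1 - f\<^sub>2)"
      by (simp add: w\<^sub>1_def w\<^sub>2_def algebra_simps)
    then have "\<bar>(w\<^sub>1 - w\<^sub>2) - (v\<^sub>1 - v\<^sub>2)\<bar> = \<epsilon> * \<bar>f\<^sub>1 - f\<^sub>2\<bar>"
      using \<epsilon>(1) by (simp add: abs_mult)
    also have "\<dots> \<le> \<epsilon> * (L * t)" using lip \<epsilon> by (intro mult_left_mono) auto
    finally show "\<bar>(w\<^sub>1 - w\<^sub>2) - (v\<^sub>1 - v\<^sub>2)\<bar> \<le> \<epsilon> * (L * t)" .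
  qed (use q H in auto)
  finally have R: "\<bar>gpow p (w\<^sub>1 - w\<^sub>2) - gpow p (v\<^sub>1 - v\<^sub>2)\<bar> \<le> H * (\<epsilon> * (L * t)) powr q" .
  have "(gpow p (w\<^sub>1 - w\<^sub>2) - gpow p (v\<^sub>1 - v\<^sub>2)) * (\<phi>\<^sub>1 - \<phi>\<^sub>2)
      \<le> \<bar>gpow p (w\<^sub>1 - w\<^sub>2) - gpow p (v\<^sub>1 - v\<^sub>2)\<bar> * \<bar>\<phi>\<^sub>1 - \<phi>\<^sub>2\<bar>"
    unfolding abs_mult[symmetric] by (rule abs_ge_self)
  also have "\<dots> \<le> H * (\<epsilon> * (L * t)) powr q * (\<phi>\<^sub>1 + \<phi>\<^sub>2)"
    by (rule mult_mono[OF R]) (use \<phi>0 H in auto)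
  finally have "(gpow p (w\<^sub>1 - w\<^sub>2) - gpow p (v\<^sub>1 - v\<^sub>2)) * (\<phi>\<^sub>1 - \<phi>\<^sub>2) \<le> H * (\<epsilon> * (L * t)) powr q * (\<phi>\<^sub>1 + \<phi>\<^sub>2)" .
  with S show ?thesis by (simp add: algebra_simps)
qed

lemma positive_gap_set:
  fixes u v :: "'a::euclidean_space \<Rightarrow> real"
  assumes [measurable]: "u \<in> borel_measurable lebesgue" "v \<in> borel_measurable lebesgue"
    and le: "AE x in lebesgue. v x \<le> u x" and ne: "\<not> (AE x in lebesgue. u x = v x)"
    and \<Omega>: "\<Omega> \<in> sets lebesgue" "bounded \<Omega>" and out: "AE x in lebesgue. x \<notin> \<Omega> \<longrightarrow> u x = v x"
  obtains \<delta> where "0 < \<delta>" "{x \<in> \<Omega>. \<delta> \<le> u x - v x} \<in> sets lebesgue"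
    "0 < measure lebesgue {x \<in> \<Omega>. \<delta> \<le> u x - v x}"
proof -
  define A where "A \<delta> = {x \<in> \<Omega>. \<delta> \<le> u x - v x}" for \<delta>
  have A: "A \<delta> \<in> sets lebesgue" for \<delta>
  proof -
    have "A \<delta> = \<Omega> \<inter> {x \<in> space lebesgue. \<delta> \<le> u x - v x}" by (auto simp: A_def)
    also have "\<dots> \<in> sets lebesgue" by (intro sets.Int \<Omega>) measurable
    finally show ?thesis .
  qed
  have "\<exists>n. 0 < measure lebesgue (A (1 / real (Suc n)))"
  proof (rule ccontr)
    assume "\<nexists>n. 0 < measure lebesgue (A (1 / real (Suc n)))"
    then have 0: "measure lebesgue (A (1 / real (Suc n))) = 0" for n
      by (metis measure_le_0_iff not_le)
    have "A (1 / real (Suc n)) \<in> null_sets lebesgue" for n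
    proof -
      have "A (1 / real (Suc n)) \<in> lmeasurable"
        by (rule bounded_set_imp_lmeasurable[OF bounded_subset[OF \<Omega>(2)] A]) (auto simp: A_def)
      then show ?thesis using 0[of n] by (simp only: negligible_iff_null_sets[symmetric] negligible_iff_measure)
    qed
    then have "AE x in lebesgue. x \<notin> A (1 / real (Suc n))" for n by (rule AE_not_in)
    then have "AE x in lebesgue. \<forall>n. x \<notin> A (1 / real (Suc n))" by (simp add: AE_all_countable)
    then have "AE x in lebesgue. u x = v x"
      using le out
    proof eventually_elim
      case (elim x)
      show ?case
      proof (rule ccontr)
        assume ne: "u x \<noteq> v x"
        then have "0 < u x - v x" "x \<in> \<Omega>" using elim by auto
        then obtain n where "1 / real (Suc n) < u x - v x"
          using reals_Archimedean[of "u x - v x"] by (auto simp: inverse_eq_divide)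
        then have "x \<in> A (1 / real (Suc n))" using \<open>x \<in> \<Omega>\<close> by (simp add: A_def)
        then show False using elim(1) by blast
      qed
    qed
    then show False using ne by contradiction
  qed
  then obtain n where "0 < measure lebesgue (A (1 / real (Suc n)))" ..
  then show ?thesis using that[of "1 / real (Suc n)"] A by (simp add: A_def)
qed

section \<open>The strong comparison principle\<close>

lemma small_power_exists:
  fixes q X Y \<epsilon>\<^sub>0 :: real
  assumes "0 < q" "0 \<le> X" "0 < Y" "0 < \<epsilon>\<^sub>0"
  obtains \<epsilon> where "0 < \<epsilon>" "\<epsilon> \<le> \<epsilon>\<^sub>0" "X * \<epsilon> powr q < Y"
proof
  define \<epsilon> where "\<epsilon> = min \<epsilon>\<^sub>0 ((Y / (X + 1)) powr (1 / q))"
  have pos: "0 < Y / (X + 1)" using assms by simp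
  then show "0 < \<epsilon>" "\<epsilon> \<le> \<epsilon>\<^sub>0" using assms by (auto simp: \<epsilon>_def)
  then have "\<epsilon> powr q \<le> ((Y / (X + 1)) powr (1 / q)) powr q"
    using assms by (intro powr_mono2) (auto simp: \<epsilon>_def)
  also have "\<dots> = Y / (X + 1)" using assms pos by (simp add: powr_powr)
  finally have "X * \<epsilon> powr q \<le> X * (Y / (X + 1))" using assms by (intro mult_left_mono) auto
  also have "\<dots> < Y" using assms by (simp add: field_simps)
  finally show "X * \<epsilon> powr q < Y" .
qed

text \<open>
  Let $f$ be a cutoff that is $1$ on $K$ and test with $\varphi = (\varepsilon f - (u-v))^+$. Since $u \ge v$ by weak
  comparison, $\varphi$ lives where $f > 0$. There $h_\Omega$ is bounded above. The set $A$ where $u - v \ge \delta$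
  has positive measure, and the kernel is bounded below on $\Omega \times \Omega$; so the pointwise estimate gives a
  loss $- Y \int \varphi$ with $Y$ independent of $\varepsilon$, whereas the error terms and the potential term are
  at most $X \varepsilon^q \int \varphi$. For small $\varepsilon$ this forces $\int \varphi = 0$, that is, $u - v \ge \varepsilon f$.
\<close>

lemma strong_comparison_bounded_v:
  fixes u v c :: "'a::euclidean_space \<Rightarrow> real"
  assumes p: "1 < p" and \<Omega>: "open \<Omega>" "bounded \<Omega>" and c: "c \<in> L_inf \<Omega>"
    and c_le: "AE x in lebesgue. x \<in> \<Omega> \<longrightarrow> c x \<le> rho DIM('a) p + h_fun p \<Omega> x"
    and u: "u \<in> X0 p \<Omega>" and v: "v \<in> X0 p \<Omega>" and v_bd: "v \<in> L_inf \<Omega>"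
    and weak: "weak_ge p \<Omega> c u v" and ne: "\<not> (AE x in lebesgue. u x = v x)"
    and K: "compact K" "K \<subseteq> \<Omega>"
  obtains \<epsilon> where "0 < \<epsilon>" "AE x in lebesgue. x \<in> K \<longrightarrow> v x + \<epsilon> \<le> u x"
proof (cases "K = {}")
  case True
  then show ?thesis using that[of 1] by simp
next
  case False
  have \<Omega>s [measurable]: "\<Omega> \<in> sets lebesgue" using \<Omega> by auto
  have um [measurable]: "u \<in> borel_measurable lebesgue" and vm [measurable]: "v \<in> borel_measurable lebesgue"
    using u v by (auto simp: X0_iff)
  have out: "AE x in lebesgue. x \<notin> \<Omega> \<longrightarrow> u x = 0 \<and> v x = 0"
  proof -
    have "AE x in lebesgue. x \<notin> \<Omega> \<longrightarrow> u x = 0" "AE x in lebesgue. x \<notin> \<Omega> \<longrightarrow> v x = 0"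
      using u v by (auto simp: X0_iff)
    then show ?thesis by eventually_elim auto
  qed
  have le: "AE x in lebesgue. v x \<le> u x"
    by (rule weak_comparison[OF p \<Omega> c c_le u v weak])
  have C: "0 < C_const DIM('a) p" by (rule C_const_pos[OF p])

  obtain M where M: "0 \<le> M" "AE x in lebesgue. x \<in> \<Omega> \<longrightarrow> \<bar>v x\<bar> \<le> M"
    using L_inf_bounded[OF v_bd \<Omega>s] by blast
  obtain Mc where Mc: "0 \<le> Mc" "AE x in lebesgue. x \<in> \<Omega> \<longrightarrow> \<bar>c x\<bar> \<le> Mc"
    using L_inf_bounded[OF c \<Omega>s] by blast
  obtain f r where r: "0 < r" and f_cont: "continuous_on UNIV f"
    and f: "\<And>x. 0 \<le> f x" "\<And>x. f x \<le> 1" "\<And>x. x \<in> K \<Longrightarrow> f x = 1"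
      "\<And>x. f x \<noteq> 0 \<Longrightarrow> ball x r \<subseteq> \<Omega>" "\<And>x y. \<bar>f x - f y\<bar> \<le> 1 / r * norm (x - y)"
    by (rule Lipschitz_cutoff[OF K(1) \<Omega>(1) K(2) False]) (rule that; assumption)
  define L where "L = 1 / r"
  have L: "0 < L" using r by (simp add: L_def)
  have fm [measurable]: "f \<in> borel_measurable lebesgue"
    using borel_measurable_continuous_onI[OF f_cont] by (intro measurable_completion) simp
  define Hh where "Hh = C_const DIM('a) p * (1 / r ^ DIM('a) * measure lborel (ball (0::'a) 1))"
  have Hh: "h_fun p \<Omega> x \<le> Hh" if "f x \<noteq> 0" for x
    unfolding Hh_def by (rule h_fun_upper_bound[OF p \<Omega>(1) r f(4)[OF that]])
  define M' where "M' = \<bar>rho DIM('a) p\<bar> + \<bar>Hh\<bar> + Mc"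
  have M': "0 \<le> M'" using Mc(1) by (simp add: M'_def)
  obtain \<delta> where \<delta>: "0 < \<delta>" "{x \<in> \<Omega>. \<delta> \<le> u x - v x} \<in> sets lebesgue"
    "0 < measure lebesgue {x \<in> \<Omega>. \<delta> \<le> u x - v x}"
  proof (rule positive_gap_set[OF um vm le ne \<Omega>s \<Omega>(2)])
    show "AE x in lebesgue. x \<notin> \<Omega> \<longrightarrow> u x = v x" using out by eventually_elim auto
  qed
  define A where "A = {x \<in> \<Omega>. \<delta> \<le> u x - v x}"
  have As [measurable]: "A \<in> sets lebesgue" and A_pos: "0 < measure lebesgue A" and A_sub: "A \<subseteq> \<Omega>"
    using \<delta> by (auto simp: A_def)
  have iA: "integrable lebesgue (indicator A :: 'a \<Rightarrow> real)"
    by (rule integrable_indicator_bounded[OF As bounded_subset[OF \<Omega>(2) A_sub]])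
  obtain b where b: "0 < b" "\<And>x. x \<in> \<Omega> \<Longrightarrow> norm x \<le> b"
    using \<Omega>(2) by (auto simp: bounded_pos)
  define R where "R = 2 * b + 1"
  have R0: "0 < R" using b by (simp add: R_def)
  have R: "norm (x - y) < R" if "x \<in> \<Omega>" "y \<in> \<Omega>" for x y
    using norm_triangle_ineq4[of x y] b(2)[OF that(1)] b(2)[OF that(2)] by (simp add: R_def)
  define q where "q = min 1 (p - 1)"
  have q: "0 < q" using p by (simp add: q_def)
  obtain H where H: "0 \<le> H"
    "\<And>a b. \<bar>a\<bar> \<le> 2 * M + 2 \<Longrightarrow> \<bar>b\<bar> \<le> 2 * M + 2 \<Longrightarrow> \<bar>gpow p a - gpow p b\<bar> \<le> H * \<bar>a - b\<bar> powr q"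
    by (rule gpow_hoelder[OF p, of "2 * M + 2", folded q_def]) (rule that; assumption)
  obtain \<eta> where \<eta>: "0 < \<eta>"
    "\<And>a b. \<bar>a\<bar> \<le> 2 * M + 2 \<Longrightarrow> b \<le> a - \<delta> / 2 \<Longrightarrow> \<eta> \<le> gpow p a - gpow p b"
    by (rule gpow_gap[OF p half_gt_zero[OF \<delta>(1)], of "2 * M + 2"]) (rule that; assumption)
  obtain J where J: "0 \<le> J" "\<And>x::'a. (\<integral>\<^sup>+ y. ennreal (riesz_kern q R (x, y)) \<partial>lebesgue) \<le> ennreal J"
    by (rule nn_integral_riesz_kern[OF q R0]) (rule that; assumption)
  \<comment> \<open>X collects the error terms and Y the gain, both as factors of the integral of \<open>\<phi>\<close>\<close>
  define X where "X = C_const DIM('a) p * H * L powr q * J + M' * H"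
  define Y where "Y = C_const DIM('a) p / 2 * (\<eta> / R ^ DIM('a) * measure lebesgue A)"
  have X: "0 \<le> X" unfolding X_def using C H(1) J(1) M' by (intro add_nonneg_nonneg mult_nonneg_nonneg) auto
  have Y: "0 < Y" unfolding Y_def using C \<eta>(1) R0 A_pos by (intro mult_pos_pos divide_pos_pos) auto
  obtain \<epsilon> where \<epsilon>: "0 < \<epsilon>" "\<epsilon> \<le> min 1 (\<delta> / 2)" "X * \<epsilon> powr q < Y"
  proof (rule small_power_exists[OF q X Y])
    show "0 < min 1 (\<delta> / 2)" using \<delta>(1) by simp
  qed (rule that)

  have f_in: "x \<in> \<Omega>" if "f x \<noteq> 0" for x
    using f(4)[OF that] r by (meson centre_in_ball subsetD)
  define \<phi> where "\<phi> x = max 0 (\<epsilon> * f x - (u x - v x))" for x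
  have \<phi>0: "0 \<le> \<phi> x" for x by (simp add: \<phi>_def)
  have d: "(\<lambda>x. u x - v x) \<in> X0 p \<Omega>"
    by (rule X0_dominated[OF u v]) (use p in auto)
  have ef: "(\<lambda>x. \<epsilon> * f x) \<in> X0 p \<Omega>"
  proof (rule Lipschitz_in_X0[OF _ \<Omega>s \<Omega>(2)])
    show "\<epsilon> * f x = 0" if "x \<notin> \<Omega>" for x using f_in[of x] that by auto
    show "\<bar>\<epsilon> * f x\<bar> \<le> \<epsilon>" for x using f(1,2)[of x] \<epsilon>(1) by (simp add: abs_mult mult_left_le)
    show "\<bar>\<epsilon> * f x - \<epsilon> * f y\<bar> \<le> (\<epsilon> * L) * norm (x - y)" for x y
    proof -
      have "\<bar>\<epsilon> * f x - \<epsilon> * f y\<bar> = \<epsilon> * \<bar>f x - f y\<bar>"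
        using \<epsilon>(1) by (simp add: right_diff_distrib[symmetric] abs_mult)
      also have "\<dots> \<le> \<epsilon> * (L * norm (x - y))"
        using \<epsilon>(1) f(5)[of x y] by (intro mult_left_mono) (auto simp: L_def)
      finally show ?thesis by (simp add: mult.assoc)
    qed
  qed (use p in auto)
  have \<phi>X: "\<phi> \<in> X0 p \<Omega>"
  proof (rule X0_dominated[OF ef d])
    show "\<phi> \<in> borel_measurable lebesgue" unfolding \<phi>_def by measurable
    show "\<bar>\<phi> x\<bar> \<le> \<bar>\<epsilon> * f x\<bar> + \<bar>u x - v x\<bar>" for x unfolding \<phi>_def by linarith
    show "\<bar>\<phi> x - \<phi> y\<bar> \<le> \<bar>\<epsilon> * f x - \<epsilon> * f y\<bar> + \<bar>(u x - v x) - (u y - v y)\<bar>" for x y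
      unfolding \<phi>_def by linarith
  qed (use p in simp)
  have \<phi>m [measurable]: "\<phi> \<in> borel_measurable lebesgue" using \<phi>X by (simp add: X0_iff)
  have good: "AE x in lebesgue. v x \<le> u x \<and> \<bar>v x\<bar> \<le> M \<and> (\<phi> x \<noteq> 0 \<longrightarrow> f x \<noteq> 0 \<and> x \<in> \<Omega>)"
    using le M(2) out
  proof eventually_elim
    case (elim x)
    have "f x \<noteq> 0" if "\<phi> x \<noteq> 0" using that elim(1) by (auto simp: \<phi>_def)
    then show ?case using f_in[of x] elim M(1) by (cases "x \<in> \<Omega>") auto
  qed
  have i\<phi>: "integrable lebesgue \<phi>"
  proof (rule Bochner_Integration.integrable_bound)
    show "integrable lebesgue (indicator \<Omega> :: 'a \<Rightarrow> real)"
      by (rule integrable_indicator_bounded[OF \<Omega>s \<Omega>(2)])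
    show "AE x in lebesgue. norm (\<phi> x) \<le> norm (indicator \<Omega> x :: real)"
      using good
    proof eventually_elim
      case (elim x)
      have "\<epsilon> * f x \<le> 1 * 1" using \<epsilon> f(1,2)[of x] by (intro mult_mono) auto
      then have "\<phi> x \<le> 1" using elim by (simp add: \<phi>_def)
      then show ?case using elim \<phi>0[of x] by (auto split: split_indicator)
    qed
  qed measurable

  define D where "D = (\<lambda>z. inside2 \<Omega> z * (pair_form p u \<phi> z - pair_form p v \<phi> z))"
  define P where "P = (\<lambda>x. indicator \<Omega> x * ((rho DIM('a) p + h_fun p \<Omega> x - c x) * ((gpow p (u x) - gpow p (v x)) * \<phi> x)))"
  have "AE x in lebesgue. 0 \<le> \<phi> x" by (simp add: \<phi>0)
  note regional = weak_ge_regional[OF p \<Omega> c u v \<phi>X weak this, folded D_def P_def]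

  define \<kappa> where "\<kappa> = H * \<epsilon> powr q * L powr q"
  have \<kappa>0: "0 \<le> \<kappa>" using H(1) by (simp add: \<kappa>_def)
  define T where "T z = \<kappa> * (\<phi> (fst z) * riesz_kern q R z + \<phi> (snd z) * riesz_kern q R (snd z, fst z))
      - \<eta> / R ^ DIM('a) * (\<phi> (fst z) * indicator A (snd z))" for z
  have i1: "integrable lebesgue2 (\<lambda>z. \<phi> (fst z) * riesz_kern q R z)"
    and le1: "(LINT z|lebesgue2. \<phi> (fst z) * riesz_kern q R z) \<le> J * integral\<^sup>L lebesgue \<phi>"
    by (rule integrable_riesz_kern_weight[OF J i\<phi> \<phi>0])+
  have i2: "integrable lebesgue2 (\<lambda>z. \<phi> (snd z) * riesz_kern q R (snd z, fst z))"
    and eq2: "(LINT z|lebesgue2. \<phi> (snd z) * riesz_kern q R (snd z, fst z)) = (LINT z|lebesgue2. \<phi> (fst z) * riesz_kern q R z)"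
    using pair_swap_lebesgue[of "\<lambda>z. \<phi> (fst z) * riesz_kern q R z"] i1 by auto
  have i3: "integrable lebesgue2 (\<lambda>z. \<phi> (fst z) * indicator A (snd z))"
    and eq3: "(LINT z|lebesgue2. \<phi> (fst z) * indicator A (snd z)) = integral\<^sup>L lebesgue \<phi> * measure lebesgue A"
    using integrable_mult_pair[OF i\<phi> iA] by auto
  have iT: "integrable lebesgue2 T" unfolding T_def using i1 i2 i3 by simp
  have D_le: "AE z in lebesgue2. D z \<le> T z"
    using AE_pair_lebesgueI[OF good]
  proof eventually_elim
    case (elim z)
    obtain x y where z: "z = (x, y)" by force
    have good_x: "\<bar>v x\<bar> \<le> M" "\<phi> x \<noteq> 0 \<longrightarrow> x \<in> \<Omega>" and good_y: "\<bar>v y\<bar> \<le> M" "\<phi> y \<noteq> 0 \<longrightarrow> y \<in> \<Omega>"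
      using elim by (auto simp: z)
    have sw: "riesz_kern q R (y, x) = riesz_kern q R (x, y)" by (rule riesz_kern_swap)
    show ?case
    proof (cases "x \<in> \<Omega> \<and> y \<in> \<Omega>")
      case False
      then have "\<phi> x * indicator A y = 0" using good_x A_sub by (auto split: split_indicator)
      then have "T z = \<kappa> * (\<phi> x * riesz_kern q R (x, y) + \<phi> y * riesz_kern q R (y, x))"
        by (simp only: T_def z fst_conv snd_conv mult_zero_right diff_0_right)
      also have "0 \<le> \<dots>"
        by (intro mult_nonneg_nonneg add_nonneg_nonneg \<kappa>0 \<phi>0 riesz_kern_nonneg)
      finally have "0 \<le> T z" .
      moreover have "D z = 0" using False by (auto simp: D_def z)
      ultimately show ?thesis by simp
    next
      case True
      define k where "k = kern x y"
      have "(gpow p (u x - u y) - gpow p (v x - v y)) * (\<phi> x - \<phi> y)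
         \<le> H * (\<epsilon> * (L * norm (x - y))) powr q * (\<phi> x + \<phi> y) - (if \<delta> \<le> u y - v y then \<eta> * \<phi> x else 0)"
        unfolding \<phi>_def
      proof (rule pair_difference_estimate[OF p _ f(1) f(2) f(1) f(2) good_x(1) good_y(1) \<epsilon>(1) _ _ H(1) \<eta>(2) H(2)])
        show "\<bar>f x - f y\<bar> \<le> L * norm (x - y)" unfolding L_def by (rule f(5))
      qed (use q \<epsilon>(2) in auto)
      also have "(if \<delta> \<le> u y - v y then \<eta> * \<phi> x else 0) = \<eta> * \<phi> x * indicator A y"
        using True by (simp add: A_def)
      also have "(\<epsilon> * (L * norm (x - y))) powr q = \<epsilon> powr q * (L powr q * norm (x - y) powr q)"
        by (simp add: powr_mult)
      finally have "(gpow p (u x - u y) - gpow p (v x - v y)) * (\<phi> x - \<phi> y) * k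
         \<le> (H * (\<epsilon> powr q * (L powr q * norm (x - y) powr q)) * (\<phi> x + \<phi> y) - \<eta> * \<phi> x * indicator A y) * k"
        by (rule mult_right_mono) (simp add: k_def)
      also have "\<dots> = \<kappa> * (\<phi> x + \<phi> y) * (norm (x - y) powr q * k) - \<eta> * \<phi> x * indicator A y * k"
        by (simp add: \<kappa>_def algebra_simps)
      finally have upper: "(gpow p (u x - u y) - gpow p (v x - v y)) * (\<phi> x - \<phi> y) * k
         \<le> \<kappa> * (\<phi> x + \<phi> y) * (norm (x - y) powr q * k) - \<eta> * \<phi> x * indicator A y * k" .
      have "\<eta> * \<phi> x * indicator A y / R ^ DIM('a) \<le> \<eta> * \<phi> x * indicator A y * k"
      proof (cases "\<phi> x * indicator A y = 0")
        case True
        then show ?thesis by (auto simp: mult_ac)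
      next
        case nz: False
        \<comment> \<open>the kernel has the value 0 on the diagonal, so its lower bound needs two distinct points\<close>
        have "x \<noteq> y"
        proof
          assume "x = y"
          moreover have "y \<in> A" using nz by (auto simp: indicator_def split: if_splits)
          ultimately have "\<delta> \<le> u x - v x" by (simp add: A_def)
          moreover have "\<epsilon> * f x \<le> \<epsilon> * 1" using \<epsilon>(1) f(2)[of x] by (intro mult_left_mono) auto
          ultimately have "\<epsilon> * f x - (u x - v x) \<le> 0" using \<epsilon>(2) \<delta>(1) by simp
          then have "\<phi> x = 0" by (simp add: \<phi>_def)
          then show False using nz by simp
        qed
        then have "1 / R ^ DIM('a) \<le> k"
          unfolding k_def kern_def using R[of x y] True R0
          by (intro divide_left_mono power_mono mult_pos_pos) auto
        then have "(\<eta> * \<phi> x * indicator A y) * (1 / R ^ DIM('a)) \<le> (\<eta> * \<phi> x * indicator A y) * k"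
          using \<eta>(1) \<phi>0[of x] by (intro mult_left_mono mult_nonneg_nonneg) auto
        then show ?thesis by simp
      qed
      with upper have main: "(gpow p (u x - u y) - gpow p (v x - v y)) * (\<phi> x - \<phi> y) * k
         \<le> \<kappa> * (\<phi> x + \<phi> y) * (norm (x - y) powr q * k) - \<eta> * \<phi> x * indicator A y / R ^ DIM('a)"
        by linarith
      have "riesz_kern q R (x, y) = norm (x - y) powr q * k"
        using R[of x y] True by (simp add: riesz_kern_def k_def)
      then have "T z = \<kappa> * (\<phi> x + \<phi> y) * (norm (x - y) powr q * k) - \<eta> * \<phi> x * indicator A y / R ^ DIM('a)"
        by (simp add: T_def z sw algebra_simps)
      moreover have "D z = (gpow p (u x - u y) - gpow p (v x - v y)) * (\<phi> x - \<phi> y) * k"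
        using True by (simp add: D_def z pair_form_def k_def algebra_simps)
      ultimately show ?thesis using main by simp
    qed
  qed
  have "integral\<^sup>L lebesgue2 D \<le> integral\<^sup>L lebesgue2 T"
    by (rule integral_mono_AE[OF regional(1) iT D_le])
  also have "\<dots> = \<kappa> * (2 * (LINT z|lebesgue2. \<phi> (fst z) * riesz_kern q R z))
      - \<eta> / R ^ DIM('a) * (integral\<^sup>L lebesgue \<phi> * measure lebesgue A)"
    unfolding T_def using i1 i2 i3 by (simp add: eq2 eq3)
  also have "\<dots> \<le> \<kappa> * (2 * (J * integral\<^sup>L lebesgue \<phi>))
      - \<eta> / R ^ DIM('a) * (integral\<^sup>L lebesgue \<phi> * measure lebesgue A)"
    using le1 \<kappa>0 by (intro diff_right_mono mult_left_mono) auto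
  finally have D_int: "integral\<^sup>L lebesgue2 D \<le> (2 * \<kappa> * J - \<eta> / R ^ DIM('a) * measure lebesgue A) * integral\<^sup>L lebesgue \<phi>"
    by (simp add: algebra_simps)

  have "AE x in lebesgue. P x \<le> M' * H * \<epsilon> powr q * \<phi> x"
    using good c_le Mc(2)
  proof eventually_elim
    case (elim x)
    show ?case
    proof (cases "\<phi> x = 0")
      case False
      then have x: "x \<in> \<Omega>" "f x \<noteq> 0" using elim by auto
      have "u x - v x < \<epsilon> * f x" using False by (simp add: \<phi>_def max_def split: if_splits)
      also have "\<epsilon> * f x \<le> \<epsilon> * 1" using \<epsilon>(1) f(2)[of x] by (intro mult_left_mono) auto
      finally have uv: "u x - v x \<le> \<epsilon>" by simp
      have "\<bar>gpow p (u x) - gpow p (v x)\<bar> \<le> H * \<bar>u x - v x\<bar> powr q"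
        by (rule H(2)) (use elim uv \<epsilon>(2) M(1) in auto)
      also have "\<dots> \<le> H * \<epsilon> powr q"
        using uv elim H(1) q by (intro mult_left_mono powr_mono2) auto
      finally have g: "gpow p (u x) - gpow p (v x) \<le> H * \<epsilon> powr q" by simp
      have g0: "0 \<le> gpow p (u x) - gpow p (v x)" using gpow_mono[OF p, of "v x" "u x"] elim by simp
      have co: "rho DIM('a) p + h_fun p \<Omega> x - c x \<le> M'"
        using Hh[OF x(2)] elim x(1) unfolding M'_def by auto
      have "(rho DIM('a) p + h_fun p \<Omega> x - c x) * ((gpow p (u x) - gpow p (v x)) * \<phi> x)
         \<le> M' * ((H * \<epsilon> powr q) * \<phi> x)"
        by (rule mult_mono[OF co mult_right_mono[OF g \<phi>0] M' mult_nonneg_nonneg[OF g0 \<phi>0]])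
      then show ?thesis using x(1) by (simp add: P_def mult.assoc)
    qed (simp add: P_def)
  qed
  then have "integral\<^sup>L lebesgue P \<le> (LINT x|lebesgue. M' * H * \<epsilon> powr q * \<phi> x)"
    using regional(2) i\<phi> by (intro integral_mono_AE) auto
  then have P_int: "integral\<^sup>L lebesgue P \<le> M' * H * \<epsilon> powr q * integral\<^sup>L lebesgue \<phi>"
    by simp
  have "0 \<le> C_const DIM('a) p / 2 * integral\<^sup>L lebesgue2 D + integral\<^sup>L lebesgue P"
    by (rule regional(3))
  also have "\<dots> \<le> C_const DIM('a) p / 2 * ((2 * \<kappa> * J - \<eta> / R ^ DIM('a) * measure lebesgue A) * integral\<^sup>L lebesgue \<phi>)
      + M' * H * \<epsilon> powr q * integral\<^sup>L lebesgue \<phi>"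
    using D_int P_int C by (intro add_mono mult_left_mono) auto
  also have "\<dots> = (X * \<epsilon> powr q - Y) * integral\<^sup>L lebesgue \<phi>"
    by (simp add: X_def Y_def \<kappa>_def algebra_simps)
  finally have "integral\<^sup>L lebesgue \<phi> \<le> 0"
    using \<epsilon>(3) by (simp add: zero_le_mult_iff)
  moreover have "0 \<le> integral\<^sup>L lebesgue \<phi>"
    by (rule Bochner_Integration.integral_nonneg) (rule \<phi>0)
  ultimately have "AE x in lebesgue. \<phi> x = 0"
    using integral_nonneg_eq_0_iff_AE[OF i\<phi>] \<phi>0 by auto
  then have "AE x in lebesgue. x \<in> K \<longrightarrow> v x + \<epsilon> \<le> u x"
    by eventually_elim (auto simp: \<phi>_def f(3) max_def split: if_splits)
  with \<epsilon>(1) show ?thesis by (rule that)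
qed

text \<open>
  Since $g$ is odd, $(u,v) \mapsto (-v,-u)$ preserves the problem; it exchanges the roles of the two
  functions and so carries the case of bounded $u$ to that of bounded $v$.
\<close>

lemma weak_ge_uminus:
  assumes "weak_ge p \<Omega> c u v"
  shows "weak_ge p \<Omega> c (\<lambda>x. - v x) (\<lambda>x. - u x)"
proof -
  have E: "E_form p (\<lambda>x. - u x) \<phi> = - E_form p u \<phi>" for u \<phi> :: "'a \<Rightarrow> real"
  proof -
    have g: "gpow p (- a - - b) = - gpow p (a - b)" for a b
      using gpow_minus[of p "a - b"] by (simp add: algebra_simps)
    have 1: "(LINT z|lebesgue2. indicator S z *\<^sub>R (case z of (x, y) \<Rightarrow> gpow p (- u x - - u y) * (\<phi> x - \<phi> y) / norm (x - y) ^ DIM('a)))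
      = - (LINT z|lebesgue2. indicator S z *\<^sub>R (case z of (x, y) \<Rightarrow> gpow p (u x - u y) * (\<phi> x - \<phi> y) / norm (x - y) ^ DIM('a)))" for S
      unfolding Bochner_Integration.integral_minus[symmetric] g
      by (intro Bochner_Integration.integral_cong refl) (auto split: prod.split)
    have 2: "(LINT z|lebesgue2. indicator S z *\<^sub>R (case z of (x, y) \<Rightarrow> (gpow p (- u x - - u y) * (\<phi> x - \<phi> y) - gpow p (- u x) * \<phi> x - gpow p (- u y) * \<phi> y) / norm (x - y) ^ DIM('a)))
      = - (LINT z|lebesgue2. indicator S z *\<^sub>R (case z of (x, y) \<Rightarrow> (gpow p (u x - u y) * (\<phi> x - \<phi> y) - gpow p (u x) * \<phi> x - gpow p (u y) * \<phi> y) / norm (x - y) ^ DIM('a)))" for S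
      unfolding Bochner_Integration.integral_minus[symmetric] g gpow_minus
      by (intro Bochner_Integration.integral_cong refl) (auto split: prod.split simp: field_simps diff_divide_distrib)
    have 3: "(LINT x|lebesgue. gpow p (- u x) * \<phi> x) = - (LINT x|lebesgue. gpow p (u x) * \<phi> x)"
      by (simp add: gpow_minus)
    show ?thesis
      unfolding E_form_def set_lebesgue_integral_def 1 2 3 by (simp add: algebra_simps)
  qed
  have I: "(LINT x:\<Omega>|lebesgue. c x * gpow p (- u x) * \<phi> x) = - (LINT x:\<Omega>|lebesgue. c x * gpow p (u x) * \<phi> x)" for u \<phi>
    by (simp add: set_lebesgue_integral_def gpow_minus)
  from assms show ?thesis unfolding weak_ge_def E I by fastforce
qed

lemma ess_inf_on_pos:
  fixes K :: "'a::euclidean_space set"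
  assumes [measurable]: "w \<in> borel_measurable lebesgue" and K: "K \<in> sets lebesgue"
    and "0 < \<epsilon>" "AE x in lebesgue. x \<in> K \<longrightarrow> \<epsilon> \<le> w x"
  shows "0 < ess_inf_on K w"
proof -
  have "w \<in> borel_measurable (lebesgue_on K)" by (rule measurable_restrict_space1) measurable
  then have [measurable]: "(\<lambda>x. - ereal (w x)) \<in> borel_measurable (lebesgue_on K)" by measurable
  have "AE x in lebesgue_on K. - ereal (w x) \<le> - ereal \<epsilon>"
    using assms(4) K by (simp add: AE_restrict_space_iff)
  then have "esssup (lebesgue_on K) (\<lambda>x. - ereal (w x)) \<le> - ereal \<epsilon>"
    by (intro esssup_I) measurable
  then have "- (- ereal \<epsilon>) \<le> ess_inf_on K w"
    unfolding ess_inf_on_def ereal_minus_le_minus .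
  then have "ereal \<epsilon> \<le> ess_inf_on K w" by simp
  moreover have "0 < ereal \<epsilon>" using assms(3) by simp
  ultimately show ?thesis by (rule less_le_trans[rotated])
qed

theorem theorem1p8:
  fixes p :: real
    and \<Omega> :: "'a::euclidean_space set"
    and c u v :: "'a \<Rightarrow> real"
  assumes "1 < p"
    and "open \<Omega>" and "bounded \<Omega>"
    and "c \<in> L_inf \<Omega>"
    and "AE x in lebesgue. x \<in> \<Omega> \<longrightarrow> c x \<le> rho DIM('a) p + h_fun p \<Omega> x"
    and "u \<in> X0 p \<Omega>" and "v \<in> X0 p \<Omega>"
    and "u \<in> L_inf \<Omega> \<or> v \<in> L_inf \<Omega>"
    and "weak_ge p \<Omega> c u v"
    and "AE x in lebesgue. x \<notin> \<Omega> \<longrightarrow> u x = 0 \<and> v x = 0"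
  shows "(AE x in lebesgue. u x = v x)
       \<or> (\<forall>K. compact K \<and> K \<subseteq> \<Omega> \<longrightarrow> ess_inf_on K (\<lambda>x. u x - v x) > 0)"
proof (cases "AE x in lebesgue. u x = v x")
  case ne: False
  have "0 < ess_inf_on K (\<lambda>x. u x - v x)" if K: "compact K" "K \<subseteq> \<Omega>" for K
  proof -
    obtain \<epsilon> where \<epsilon>: "0 < \<epsilon>" "AE x in lebesgue. x \<in> K \<longrightarrow> v x + \<epsilon> \<le> u x"
      using assms(8)
    proof
      assume "v \<in> L_inf \<Omega>"
      then show ?thesis
        using strong_comparison_bounded_v[OF assms(1-7) _ assms(9) ne K] that by blast
    next
      assume "u \<in> L_inf \<Omega>"
      have ne': "\<not> (AE x in lebesgue. - v x = - u x)" using ne by (simp add: eq_commute)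
      obtain \<epsilon> where "0 < \<epsilon>" "AE x in lebesgue. x \<in> K \<longrightarrow> - u x + \<epsilon> \<le> - v x"
        using strong_comparison_bounded_v[OF assms(1-5) X0_uminus[OF assms(7)] X0_uminus[OF assms(6)]
            L_inf_uminus[OF \<open>u \<in> L_inf \<Omega>\<close>] weak_ge_uminus[OF assms(9)] ne' K] by blast
      then show ?thesis using that[of \<epsilon>] by (simp add: algebra_simps)
    qed
    show ?thesis
    proof (rule ess_inf_on_pos[OF _ _ \<epsilon>(1)])
      show "(\<lambda>x. u x - v x) \<in> borel_measurable lebesgue" using assms(6,7) by (auto simp: X0_iff)
      show "K \<in> sets lebesgue" using K by (auto simp: compact_imp_closed)
      show "AE x in lebesgue. x \<in> K \<longrightarrow> \<epsilon> \<le> u x - v x" using \<epsilon>(2) by eventually_elim auto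
    qed
  qed
  then show ?thesis by blast
qed simp

end
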